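(* Suppose $H$ is a Hilbert space, $\mathcal{A}$ is an irreducible $C^*$-subalgebra of $B(H)$, $S : \mathcal{A} \to B(H)$ is a compact operator, $x \in B(H)$, and $0 \leq M_x \leq S$, where $M_x:\mathcal{A}\to B(H)$ is given by $M_x(a)=x^*ax$. Then $M_x$ is compact.
   Context: Operators between operator algebras are bounded linear maps; $T\ge 0$ means that $T$ maps positive elements to positive elements, and $T\le S$ means $S-T\ge 0$. *)

theory Defs
  imports "HOL-Analysis.Analysis"
begin

text \<open>The inner product is linear in the first argument.\<close>

class complex_inner = real_normed_vector +
  fixes scaleC :: "complex \<Rightarrow> 'a \<Rightarrow> 'a" (infixr "*\<^sub>C" 75)
    and cinner :: "'a \<Rightarrow> 'a \<Rightarrow> complex"
  assumes scaleC_add_right: "c *\<^sub>C (x + y) = c *\<^sub>C x + c *\<^sub>C y"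
    and scaleC_add_left: "(c + d) *\<^sub>C x = c *\<^sub>C x + d *\<^sub>C x"
    and scaleC_scaleC: "c *\<^sub>C d *\<^sub>C x = (c * d) *\<^sub>C x"
    and scaleR_scaleC: "r *\<^sub>R x = complex_of_real r *\<^sub>C x"
    and cinner_commute: "cinner x y = cnj (cinner y x)"
    and cinner_add_left: "cinner (x + y) z = cinner x z + cinner y z"
    and cinner_scaleC_left: "cinner (c *\<^sub>C x) y = c * cinner x y"
    and cinner_self_nonneg: "0 \<le> Re (cinner x x)"
    and norm_eq_sqrt_cinner: "norm x = sqrt (Re (cinner x x))"

class chilbert_space = complex_inner + complete_space

lemma norm_scaleC: "norm (c *\<^sub>C x) = cmod c * norm (x :: 'a::complex_inner)"
proof -
  have "cinner (c *\<^sub>C x) (c *\<^sub>C x) = c * (cnj c * cnj (cinner x x))"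
    by (metis cinner_scaleC_left cinner_commute complex_cnj_mult)
  also have "\<dots> = complex_of_real ((cmod c)\<^sup>2) * cinner x x"
    by (metis cinner_commute complex_norm_square mult.assoc)
  finally have "Re (cinner (c *\<^sub>C x) (c *\<^sub>C x)) = (cmod c)\<^sup>2 * Re (cinner x x)"
    by simp
  then show ?thesis
    by (simp add: norm_eq_sqrt_cinner real_sqrt_mult)
qed

text \<open>
  Operators on \<open>H\<close> are elements of the real normed space of real-linear bounded maps
  (whose norm is the operator norm); \<open>B(H)\<close> is the closed subspace of the complex-linear ones.
\<close>

type_synonym 'h operator = "'h \<Rightarrow>\<^sub>L 'h"

definition bounded_operators :: "'h::chilbert_space operator set" where
  "bounded_operators = {T. \<forall>c v. blinfun_apply T (c *\<^sub>C v) = c *\<^sub>C blinfun_apply T v}"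

lift_definition scaleC_operator ::
  "complex \<Rightarrow> 'h::chilbert_space operator \<Rightarrow> 'h operator" is "\<lambda>c T v. c *\<^sub>C T v"
proof -
  fix c :: complex and T :: "'h \<Rightarrow> 'h"
  assume "bounded_linear T"
  moreover have "bounded_linear (\<lambda>v::'h. c *\<^sub>C v)"
    by (rule bounded_linear_intro[where K = "cmod c"])
      (simp_all add: scaleC_add_right scaleR_scaleC scaleC_scaleC norm_scaleC mult.commute)
  ultimately show "bounded_linear (\<lambda>v. c *\<^sub>C T v)"
    by (rule bounded_linear_compose[rotated])
qed

text \<open>For \<open>T\<close> in \<open>B(H)\<close> the adjoint exists (Riesz) and is unique.\<close>

definition adj :: "'h::chilbert_space operator \<Rightarrow> 'h operator" where
  "adj T = (THE R. \<forall>v w. cinner (blinfun_apply R v) w = cinner v (blinfun_apply T w))"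

definition positive_operator :: "'h::chilbert_space operator \<Rightarrow> bool" where
  "positive_operator T \<longleftrightarrow>
     T \<in> bounded_operators \<and> (\<forall>v. cinner (blinfun_apply T v) v \<in> \<real>\<^sub>\<ge>\<^sub>0)"

text \<open>C*-subalgebras are not required to contain the identity.\<close>

definition cstar_subalgebra :: "'h::chilbert_space operator set \<Rightarrow> bool" where
  "cstar_subalgebra A \<longleftrightarrow>
     A \<subseteq> bounded_operators \<and> 0 \<in> A \<and>
     (\<forall>a\<in>A. \<forall>b\<in>A. a + b \<in> A) \<and>
     (\<forall>c. \<forall>a\<in>A. scaleC_operator c a \<in> A) \<and>
     (\<forall>a\<in>A. \<forall>b\<in>A. a o\<^sub>L b \<in> A) \<and>
     (\<forall>a\<in>A. adj a \<in> A) \<and>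
     closed A"

definition csubspace :: "'h::chilbert_space set \<Rightarrow> bool" where
  "csubspace V \<longleftrightarrow>
     0 \<in> V \<and> (\<forall>v\<in>V. \<forall>w\<in>V. v + w \<in> V) \<and> (\<forall>c. \<forall>v\<in>V. c *\<^sub>C v \<in> V)"

definition irreducible_operators :: "'h::chilbert_space operator set \<Rightarrow> bool" where
  "irreducible_operators A \<longleftrightarrow>
     (\<forall>V. csubspace V \<and> closed V \<and> (\<forall>a\<in>A. \<forall>v\<in>V. blinfun_apply a v \<in> V)
        \<longrightarrow> V = {0} \<or> V = UNIV)"

text \<open>
  A map from a subalgebra \<open>A\<close> to \<open>B(H)\<close> is a HOL function of which only the values on \<open>A\<close> matter.
\<close>

definition bounded_clinear_on ::
  "'h::chilbert_space operator set \<Rightarrow> ('h operator \<Rightarrow> 'h operator) \<Rightarrow> bool" where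
  "bounded_clinear_on A T \<longleftrightarrow>
     T ` A \<subseteq> bounded_operators \<and>
     (\<forall>a\<in>A. \<forall>b\<in>A. T (a + b) = T a + T b) \<and>
     (\<forall>c. \<forall>a\<in>A. T (scaleC_operator c a) = scaleC_operator c (T a)) \<and>
     (\<exists>K. \<forall>a\<in>A. norm (T a) \<le> K * norm a)"

definition compact_operator_on ::
  "'h::chilbert_space operator set \<Rightarrow> ('h operator \<Rightarrow> 'h operator) \<Rightarrow> bool" where
  "compact_operator_on A T \<longleftrightarrow>
     bounded_clinear_on A T \<and> compact (closure (T ` (A \<inter> cball 0 1)))"

definition positive_map_on ::
  "'h::chilbert_space operator set \<Rightarrow> ('h operator \<Rightarrow> 'h operator) \<Rightarrow> bool" where
  "positive_map_on A T \<longleftrightarrow> (\<forall>a\<in>A. positive_operator a \<longrightarrow> positive_operator (T a))"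

definition map_le_on ::
  "'h::chilbert_space operator set \<Rightarrow> ('h operator \<Rightarrow> 'h operator) \<Rightarrow>
     ('h operator \<Rightarrow> 'h operator) \<Rightarrow> bool" where
  "map_le_on A T S \<longleftrightarrow> positive_map_on A (\<lambda>a. S a - T a)"

definition conj_map :: "'h::chilbert_space operator \<Rightarrow> 'h operator \<Rightarrow> 'h operator" where
  "conj_map x a = adj x o\<^sub>L a o\<^sub>L x"

end

theory Submission
  imports Defs
begin

text \<open>
  The proof shows that \<open>x\<close> is a compact operator; compactness of \<open>a \<mapsto> x\<^sup>* a x\<close> then
  follows by approximating \<open>x\<close> with finite-rank operators
  (\<open>conj_map_compact\<close>).

  If \<open>x\<close> is not compact, then there are, for some \<open>r > 0\<close> and every \<open>N\<close>, vectors \<open>e\<^sub>1, \<dots>, e\<^sub>N\<close> of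
  norm at most \<open>1/r\<close> with \<open>x e\<^sub>1, \<dots>, x e\<^sub>N\<close> orthonormal. Irreducibility provides positive elements
  \<open>a\<^sub>1, \<dots>, a\<^sub>N\<close> of \<open>A\<close> with \<open>\<langle>a\<^sub>i x e\<^sub>i, x e\<^sub>i\<rangle> \<ge> 1/4\<close> and \<open>\<parallel>\<Sum>a\<^sub>i\<parallel> \<le> 2\<close>, the bounds being independent of
  \<open>N\<close> (\<open>positive_elements_separating_orthonormal\<close>). Domination gives \<open>\<langle>S(a\<^sub>i) e\<^sub>i, e\<^sub>i\<rangle> \<ge> 1/4\<close>. By
  compactness of \<open>S\<close>, for large \<open>N\<close> many of the \<open>S(a\<^sub>i)\<close> nearly coincide, so many of the nonnegative
  numbers \<open>\<langle>S(a\<^sub>j) e\<^sub>i, e\<^sub>i\<rangle>\<close> with \<open>i\<close> fixed are bounded below; but their sum is at most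
  \<open>\<parallel>S(\<Sum>a\<^sub>j)\<parallel> / r\<^sup>2\<close>, which is bounded independently of \<open>N\<close>
  (\<open>small_on_finite_codimension_if_dominated\<close>).

  The elements \<open>a\<^sub>i\<close> are differences of the rational functions \<open>d\<^sup>2 (d\<^sup>2 + t)\<^sup>-\<^sup>1\<close>, for varying \<open>t\<close>, of one
  self-adjoint \<open>d \<in> A\<close> that nearly has the \<open>x e\<^sub>i\<close> as eigenvectors with rapidly growing eigenvalues;
  only the quality of the approximation, not the norm of \<open>d\<close>, enters the estimates. Such a \<open>d\<close>
  comes from the density theorem (\<open>irreducible_strongly_dense\<close>,
  \<open>symmetric_elements_dense_diagonal\<close>), which rests on Schur's lemma: the commutant of \<open>A\<close> consists
  of scalars. For a self-adjoint \<open>T\<close> in the commutant this is seen from the invariant kernel of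
  \<open>\<bar>T\<bar> + T\<close>, where \<open>\<bar>T\<bar>\<close> is constructed by an elementary iteration (\<open>symmetric_modulus\<close>).
\<close>

instance chilbert_space \<subseteq> banach ..

section \<open>Complex inner products\<close>

lemma cinner_add_right: "cinner x (y + z) = cinner x y + cinner (x :: 'a::complex_inner) z"
  by (metis cinner_add_left cinner_commute complex_cnj_add)

lemma cinner_scaleC_right: "cinner x (c *\<^sub>C y) = cnj c * cinner (x :: 'a::complex_inner) y"
  by (metis cinner_scaleC_left cinner_commute complex_cnj_mult)

lemma scaleC_one [simp]: "1 *\<^sub>C x = (x :: 'a::complex_inner)"
  by (metis of_real_1 scaleR_one scaleR_scaleC)

lemma cinner_scaleR_left: "cinner (r *\<^sub>R x) y = r *\<^sub>R cinner (x :: 'a::complex_inner) y"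
  by (simp add: scaleR_scaleC cinner_scaleC_left scaleR_conv_of_real)

lemma cinner_scaleR_right: "cinner x (r *\<^sub>R y) = r *\<^sub>R cinner (x :: 'a::complex_inner) y"
  by (simp add: scaleR_scaleC cinner_scaleC_right scaleR_conv_of_real)

lemma cinner_self: "cinner x x = complex_of_real ((norm (x :: 'a::complex_inner))\<^sup>2)"
proof -
  have "Im (cinner x x) = 0"
    using cinner_commute[of x x] by (metis complex_cnj_cancel_iff Reals_cnj_iff complex_is_Real_iff)
  then show ?thesis
    by (simp add: complex_eq_iff norm_eq_sqrt_cinner cinner_self_nonneg)
qed

lemma power2_norm_add:
  "(norm (x + y))\<^sup>2 = (norm x)\<^sup>2 + 2 * Re (cinner x y) + (norm (y :: 'a::complex_inner))\<^sup>2"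
proof -
  have "complex_of_real ((norm (x + y))\<^sup>2) = cinner (x + y) (x + y)"
    by (simp only: cinner_self)
  also have "\<dots> = cinner x x + cinner x y + cnj (cinner x y) + cinner y y"
    by (simp add: cinner_add_left cinner_add_right cinner_commute[of y x])
  finally have "Re (complex_of_real ((norm (x + y))\<^sup>2)) = Re (cinner x x + cinner x y + cnj (cinner x y) + cinner y y)"
    by simp
  then show ?thesis by (simp add: cinner_self)
qed

lemma Re_cinner_le: "Re (cinner x y) \<le> norm x * norm (y :: 'a::complex_inner)"
proof -
  have "(norm (x + y))\<^sup>2 \<le> (norm x + norm y)\<^sup>2"
    by (intro power_mono norm_triangle_ineq) simp
  then show ?thesis by (simp add: power2_norm_add power2_sum)
qed

lemma norm_cinner_le: "cmod (cinner x y) \<le> norm x * norm (y :: 'a::complex_inner)"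
proof (cases "cinner x y = 0")
  case False
  define c where "c = cnj (sgn (cinner x y))"
  have "c * cinner x y = complex_of_real (cmod (cinner x y))"
    unfolding c_def using False
    by (simp add: sgn_div_norm scaleR_conv_of_real complex_norm_square[symmetric] field_simps power2_eq_square)
  then have "cmod (cinner x y) = Re (cinner (c *\<^sub>C x) y)"
    by (simp add: cinner_scaleC_left)
  also have "\<dots> \<le> norm (c *\<^sub>C x) * norm y" by (rule Re_cinner_le)
  also have "\<dots> = norm x * norm y" using False by (simp add: norm_scaleC c_def norm_sgn)
  finally show ?thesis .
qed simp

interpretation cinner: bounded_bilinear "cinner :: 'a::complex_inner \<Rightarrow> 'a \<Rightarrow> complex"
  by standard
    (auto simp: cinner_add_left cinner_add_right cinner_scaleR_left cinner_scaleR_right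
      intro!: exI[of _ 1] norm_cinner_le)

interpretation scaleC: bounded_bilinear "scaleC :: complex \<Rightarrow> 'a::complex_inner \<Rightarrow> 'a"
  by standard
    (auto simp: scaleC_add_left scaleC_add_right scaleR_scaleC scaleC_scaleC norm_scaleC
      scaleR_conv_of_real mult.commute intro!: exI[of _ 1])

lemma Re_cinner_self: "Re (cinner x x) = (norm (x :: 'a::complex_inner))\<^sup>2"
  by (simp add: cinner_self)

lemma Re_cinner_commute: "Re (cinner x y) = Re (cinner y (x :: 'a::complex_inner))"
  by (metis cinner_commute complex_cnj cnj.simps(1))

lemma power2_norm_diff:
  "(norm (x - y))\<^sup>2 = (norm x)\<^sup>2 - 2 * Re (cinner x y) + (norm (y :: 'a::complex_inner))\<^sup>2"
  using power2_norm_add[of x "- y"] by (simp add: cinner.minus_right)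

section \<open>Bounded functionals on subspaces of finite powers of a Hilbert space\<close>

lemma linear_le_quadratic_imp_zero:
  fixes q b :: real
  assumes "\<And>t. 0 \<le> t\<^sup>2 * q + 2 * t * b"
  shows "b = 0"
proof (rule ccontr)
  assume "b \<noteq> 0"
  define s where "s = 1 / (\<bar>q\<bar> + 1)"
  have s: "s > 0" "s * q < 1" by (auto simp: s_def field_simps)
  have "0 \<le> (- s * b)\<^sup>2 * q + 2 * (- s * b) * b" by (rule assms)
  also have "\<dots> = b\<^sup>2 * s * (s * q - 2)" by (simp add: power2_eq_square algebra_simps)
  also have "\<dots> < 0" using s \<open>b \<noteq> 0\<close> by (intro mult_pos_neg) auto
  finally show False by simp
qed

text \<open>
  The Riesz representation theorem on the closure of a real subspace \<open>V\<close> of the Hilbert space \<open>H\<^sup>I\<close>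
  with \<open>I\<close> finite: the representing vector is the limit of a minimising sequence of
  \<open>v \<mapsto> \<parallel>v\<parallel>\<^sup>2 - 2 \<phi>(v)\<close>. Tuples are functions on the index type of which only the values on
  \<open>I\<close> matter. For \<open>I\<close> a singleton it yields adjoints; for \<open>\<phi>\<close> the pairing with a given tuple, it
  yields orthogonal projections.
\<close>

lemma functional_represented_in_closure:
  fixes V :: "('i \<Rightarrow> 'h::chilbert_space) set" and \<phi> :: "('i \<Rightarrow> 'h) \<Rightarrow> real"
  assumes I: "finite I"
    and V0: "V \<noteq> {}"
    and Vadd: "\<And>v w. v \<in> V \<Longrightarrow> w \<in> V \<Longrightarrow> (\<lambda>i. v i + w i) \<in> V"
    and Vscale: "\<And>r v. v \<in> V \<Longrightarrow> (\<lambda>i. r *\<^sub>R v i) \<in> V"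
    and \<phi>add: "\<And>v w. v \<in> V \<Longrightarrow> w \<in> V \<Longrightarrow> \<phi> (\<lambda>i. v i + w i) = \<phi> v + \<phi> w"
    and \<phi>scale: "\<And>r v. v \<in> V \<Longrightarrow> \<phi> (\<lambda>i. r *\<^sub>R v i) = r * \<phi> v"
    and bound: "\<And>v. v \<in> V \<Longrightarrow> (\<phi> v)\<^sup>2 \<le> K * (\<Sum>i\<in>I. (norm (v i))\<^sup>2)"
  obtains p vs where "\<And>k. vs k \<in> V" "\<And>i. i \<in> I \<Longrightarrow> (\<lambda>k::nat. vs k i) \<longlonglongrightarrow> p i"
    "\<And>v. v \<in> V \<Longrightarrow> Re (\<Sum>i\<in>I. cinner (v i) (p i)) = \<phi> v"
proof -
  define Q where "Q v = (\<Sum>i\<in>I. (norm (v i))\<^sup>2)" for v :: "'i \<Rightarrow> 'h"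
  define B where "B v w = Re (\<Sum>i\<in>I. cinner (v i) (w i))" for v w :: "'i \<Rightarrow> 'h"
  define F where "F v = Q v - 2 * \<phi> v" for v
  define d where "d = Inf (F ` V)"
  have Qnn: "0 \<le> Q v" for v by (simp add: Q_def sum_nonneg)
  have lower: "- (\<bar>K\<bar> + 1) \<le> F v" if "v \<in> V" for v
  proof -
    let ?K = "\<bar>K\<bar> + 1"
    have "(\<phi> v)\<^sup>2 \<le> ?K * Q v"
      using order.trans[OF bound[OF that, folded Q_def] mult_right_mono[OF _ Qnn]] by simp
    also have "\<dots> \<le> ((Q v + ?K) / 2)\<^sup>2"
      using zero_le_power2[of "Q v - ?K"] by (simp add: power2_eq_square field_simps)
    finally have "\<bar>\<phi> v\<bar> \<le> (Q v + ?K) / 2"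
      using Qnn[of v] by (subst (asm) abs_le_square_iff[symmetric]) auto
    then show ?thesis by (simp add: F_def abs_le_iff)
  qed
  have bdd: "bdd_below (F ` V)" using lower by (auto intro!: bdd_belowI)
  have d_le: "d \<le> F v" if "v \<in> V" for v
    unfolding d_def using bdd that by (auto intro: cInf_lower)
  have "\<exists>v\<in>V. F v < d + 1 / real (Suc k)" for k
  proof -
    have "\<exists>y\<in>F ` V. y < d + 1 / real (Suc k)"
      using V0 bdd cInf_less_iff[of "F ` V" "d + 1 / real (Suc k)"] by (simp add: d_def)
    then show ?thesis by blast
  qed
  then obtain vs where vs: "\<And>k. vs k \<in> V" "\<And>k. F (vs k) < d + 1 / real (Suc k)"
    by metis
  have Qadd: "Q (\<lambda>i. v i + t *\<^sub>R w i) = Q v + 2 * t * B v w + t\<^sup>2 * Q w" for v w t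
    by (simp add: Q_def B_def power2_norm_add cinner_scaleR_right power_mult_distrib
        sum.distrib sum_distrib_left algebra_simps)
  have Fadd: "F (\<lambda>i. v i + t *\<^sub>R w i) = F v + 2 * t * (B v w - \<phi> w) + t\<^sup>2 * Q w"
    if "v \<in> V" "w \<in> V" for v w t
    using that by (simp add: F_def Qadd \<phi>add \<phi>scale Vscale algebra_simps)
  \<comment> \<open>The parallelogram law makes every minimising sequence Cauchy.\<close>
  have par: "Q (\<lambda>i. v i - w i) \<le> 2 * F v + 2 * F w - 4 * d" if "v \<in> V" "w \<in> V" for v w
  proof -
    have Qhalf: "Q (\<lambda>i. (1/2) *\<^sub>R u i) = Q u / 4" for u
      by (simp add: Q_def power_mult_distrib sum_divide_distrib power2_eq_square)
    let ?m = "\<lambda>i. (1/2) *\<^sub>R (v i + 1 *\<^sub>R w i)"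
    have m: "?m \<in> V" using that by (intro Vscale) (simp add: Vadd)
    have "\<phi> ?m = (\<phi> v + \<phi> w) / 2"
      using that \<phi>scale[of "\<lambda>i. v i + w i" "1/2"] by (simp add: Vadd \<phi>add)
    moreover have "Q ?m = (Q v + 2 * B v w + Q w) / 4"
      using Qadd[of v 1 w] Qhalf[of "\<lambda>i. v i + 1 *\<^sub>R w i"] by simp
    moreover have "Q (\<lambda>i. v i - w i) = Q v - 2 * B v w + Q w"
      using Qadd[of v "-1" w] by simp
    ultimately have "2 * F v + 2 * F w - 4 * F ?m = Q (\<lambda>i. v i - w i)"
      by (simp add: F_def field_simps)
    then show ?thesis using d_le[OF m] by linarith
  qed
  have "Cauchy (\<lambda>k. vs k i)" if "i \<in> I" for i
  proof (rule metric_CauchyI)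
    fix e :: real assume "0 < e"
    then obtain n where n: "1 / real (Suc n) < e\<^sup>2 / 4"
      by (metis nat_approx_posE zero_less_power divide_pos_pos zero_less_numeral)
    have "dist (vs k i) (vs l i) < e" if "n \<le> k" "n \<le> l" for k l
    proof -
      have le: "1 / real (Suc k) \<le> 1 / real (Suc n)" "1 / real (Suc l) \<le> 1 / real (Suc n)"
        using that by (auto intro!: divide_left_mono)
      have "(norm (vs k i - vs l i))\<^sup>2 \<le> Q (\<lambda>i. vs k i - vs l i)"
        unfolding Q_def using I \<open>i \<in> I\<close> by (intro member_le_sum) auto
      also have "\<dots> \<le> 2 * F (vs k) + 2 * F (vs l) - 4 * d" by (rule par) (rule vs)+
      also have "\<dots> < e\<^sup>2" using vs(2)[of k] vs(2)[of l] le n by linarith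
      finally show ?thesis
        using \<open>0 < e\<close> by (simp add: dist_norm power2_less_imp_less)
    qed
    then show "\<exists>M. \<forall>m\<ge>M. \<forall>n\<ge>M. dist (vs m i) (vs n i) < e" by blast
  qed
  then have "\<forall>i\<in>I. \<exists>l. (\<lambda>k. vs k i) \<longlonglongrightarrow> l" by (simp add: Cauchy_convergent_iff convergent_def)
  then obtain p where p: "\<And>i. i \<in> I \<Longrightarrow> (\<lambda>k. vs k i) \<longlonglongrightarrow> p i" by metis
  have "Re (\<Sum>i\<in>I. cinner (v i) (p i)) = \<phi> v" if v: "v \<in> V" for v
  proof -
    have limB: "(\<lambda>k. B (vs k) v) \<longlonglongrightarrow> B p v"
      unfolding B_def by (intro tendsto_Re tendsto_sum cinner.tendsto p tendsto_const)
    \<comment> \<open>First-order condition at the minimum, in the direction \<open>v\<close>.\<close>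
    have "B p v - \<phi> v = 0"
    proof (rule linear_le_quadratic_imp_zero)
      fix t :: real
      have "(\<lambda>k. 1 / real (Suc k) + 2 * t * (B (vs k) v - \<phi> v) + t\<^sup>2 * Q v)
          \<longlonglongrightarrow> 0 + 2 * t * (B p v - \<phi> v) + t\<^sup>2 * Q v"
        by (intro tendsto_intros limB LIMSEQ_Suc[OF lim_1_over_n])
      moreover have "0 \<le> 1 / real (Suc k) + 2 * t * (B (vs k) v - \<phi> v) + t\<^sup>2 * Q v" for k
      proof -
        have "d \<le> F (\<lambda>i. vs k i + t *\<^sub>R v i)"
          using vs(1) v by (intro d_le Vadd Vscale)
        then show ?thesis using Fadd[OF vs(1) v, of k t] vs(2)[of k] by linarith
      qed
      ultimately have "0 \<le> 0 + 2 * t * (B p v - \<phi> v) + t\<^sup>2 * Q v"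
        by (meson LIMSEQ_le_const)
      then show "0 \<le> t\<^sup>2 * Q v + 2 * t * (B p v - \<phi> v)" by simp
    qed
    moreover have "B p v = B v p"
      unfolding B_def by (simp add: Re_cinner_commute)
    ultimately show ?thesis by (simp add: B_def)
  qed
  with vs(1) p show ?thesis using that by blast
qed

interpretation blinfun_compose: bounded_bilinear
  "(o\<^sub>L) :: ('b::real_normed_vector \<Rightarrow>\<^sub>L 'c::real_normed_vector) \<Rightarrow> ('a::real_normed_vector \<Rightarrow>\<^sub>L 'b) \<Rightarrow> _"
  by (rule bounded_bilinear_blinfun_compose)

lemma blinfun_compose_assoc: "(f o\<^sub>L g) o\<^sub>L h = f o\<^sub>L (g o\<^sub>L h)"
  by (rule blinfun_eqI) simp

lemma blinfun_compose_id [simp]: "f o\<^sub>L id_blinfun = f" "id_blinfun o\<^sub>L f = f"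
  by (rule blinfun_eqI, simp)+

section \<open>Adjoints and symmetric operators\<close>

lemma cinner_eqI: "x = y" if "\<And>w. cinner w x = cinner (w :: 'a::complex_inner) y"
proof -
  have "cinner (x - y) (x - y) = 0" by (simp add: cinner.diff_right that)
  then show ?thesis by (simp add: cinner_self)
qed

lemma complex_eq_from_Re:
  assumes "\<And>c. Re (c * z) = Re (c * w)"
  shows "z = w"
  using assms[of 1] assms[of \<i>] by (simp add: complex_eq_iff)

lemma bounded_operators_scaleC:
  "T \<in> bounded_operators \<Longrightarrow> blinfun_apply T (c *\<^sub>C v) = c *\<^sub>C blinfun_apply T v"
  by (simp add: bounded_operators_def)

lemma adj_exists:
  fixes T :: "'h::chilbert_space operator"
  assumes T: "T \<in> bounded_operators"
  obtains R where "\<And>v w. cinner (blinfun_apply R v) w = cinner v (blinfun_apply T w)"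
proof -
  have "\<exists>z. \<forall>w. cinner w z = cinner (T w) v" for v
  proof -
    obtain p :: "unit \<Rightarrow> 'h" where p:
      "\<And>u. u \<in> UNIV \<Longrightarrow> Re (\<Sum>i\<in>{()}. cinner (u i) (p i)) = Re (cinner (T (u ())) v)"
    proof (rule functional_represented_in_closure[of "{()}" UNIV "\<lambda>u. Re (cinner (T (u ())) v)" "(norm T * norm v)\<^sup>2"])
      show "(Re (cinner (T (u ())) v))\<^sup>2 \<le> (norm T * norm v)\<^sup>2 * (\<Sum>i\<in>{()}. (norm (u i))\<^sup>2)" for u
      proof -
        have "\<bar>Re (cinner (T (u ())) v)\<bar> \<le> norm (T (u ())) * norm v"
          using abs_Re_le_cmod norm_cinner_le order_trans by blast
        also have "\<dots> \<le> norm T * norm (u ()) * norm v"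
          by (intro mult_right_mono norm_blinfun) simp
        finally have "(Re (cinner (T (u ())) v))\<^sup>2 \<le> (norm T * norm (u ()) * norm v)\<^sup>2"
          by (subst abs_le_square_iff[symmetric]) simp
        then show ?thesis by (simp add: power_mult_distrib mult_ac)
      qed
    qed (auto simp: blinfun.add_right blinfun.scaleR_right cinner_add_left cinner_scaleR_left)
    have Re_eq: "Re (cinner w (p ())) = Re (cinner (T w) v)" for w
      using p[of "\<lambda>_. w"] by simp
    have "cinner w (p ()) = cinner (T w) v" for w
    proof (rule complex_eq_from_Re)
      show "Re (c * cinner w (p ())) = Re (c * cinner (T w) v)" for c
        using Re_eq[of "c *\<^sub>C w"] by (simp add: bounded_operators_scaleC[OF T] cinner_scaleC_left)
    qed
    then show ?thesis by blast
  qed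
  then obtain R where "\<And>v w. cinner w (R v) = cinner (T w) v" by metis
  then have R: "\<And>v w. cinner (R v) w = cinner v (T w)"
    by (metis cinner_commute)
  have "bounded_linear R"
  proof (rule bounded_linear_intro[where K = "norm T"])
    show "R (x + y) = R x + R y" for x y
      by (rule cinner_eqI) (metis R cinner_commute cinner_add_left)
    show "R (r *\<^sub>R x) = r *\<^sub>R R x" for r x
    proof (rule cinner_eqI)
      fix w
      have "cinner (R (r *\<^sub>R x)) w = cinner (r *\<^sub>R R x) w" by (simp add: R cinner_scaleR_left)
      then show "cinner w (R (r *\<^sub>R x)) = cinner w (r *\<^sub>R R x)" by (metis cinner_commute)
    qed
    show "norm (R x) \<le> norm x * norm T" for x
    proof (cases "R x = 0")
      case False
      have "norm (R x) * norm (R x) = Re (cinner x (T (R x)))"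
        using Re_cinner_self[of "R x"] by (simp add: R power2_eq_square)
      also have "\<dots> \<le> norm x * norm (T (R x))" by (rule Re_cinner_le)
      also have "\<dots> \<le> norm x * (norm T * norm (R x))"
        by (intro mult_left_mono norm_blinfun) simp
      finally show ?thesis using False by simp
    qed simp
  qed
  then have "cinner (blinfun_apply (Blinfun R) v) w = cinner v (T w)" for v w
    by (simp add: bounded_linear_Blinfun_apply R)
  then show ?thesis using that by blast
qed

lemma cinner_adj:
  fixes T :: "'h::chilbert_space operator"
  assumes "T \<in> bounded_operators"
  shows "cinner (adj T v) w = cinner v (T w)"
proof -
  obtain R where R: "\<And>v w. cinner (blinfun_apply R v) w = cinner v (T w)"
    using adj_exists[OF assms] by blast
  have "\<forall>v w. cinner (adj T v) w = cinner v (T w)"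
    unfolding adj_def
  proof (rule theI)
    show "\<forall>v w. cinner (R v) w = cinner v (T w)" by (simp add: R)
    fix R' assume R': "\<forall>v w. cinner (blinfun_apply R' v) w = cinner v (T w)"
    show "R' = R"
    proof (rule blinfun_eqI, rule cinner_eqI)
      show "cinner w (R' v) = cinner w (R v)" for v w
        by (metis R R' cinner_commute)
    qed
  qed
  then show ?thesis by blast
qed

lemma cinner_adj_right:
  "T \<in> bounded_operators \<Longrightarrow> cinner v (adj T w) = cinner (blinfun_apply T v) w"
  by (metis cinner_adj cinner_commute)

lemma adj_in_bounded_operators:
  fixes T :: "'h::chilbert_space operator"
  assumes "T \<in> bounded_operators"
  shows "adj T \<in> bounded_operators"
  unfolding bounded_operators_def
proof (intro CollectI allI cinner_eqI)
  show "cinner w (adj T (c *\<^sub>C v)) = cinner w (c *\<^sub>C adj T v)" for c v w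
    by (simp add: cinner_adj_right assms cinner_scaleC_right)
qed

text \<open>Self-adjointness, stated through the form so that it needs no adjoint.\<close>

definition symmetric_operator :: "'h::chilbert_space operator \<Rightarrow> bool" where
  "symmetric_operator T \<longleftrightarrow>
     (\<forall>v w. cinner (blinfun_apply T v) w = cinner v (blinfun_apply T w))"

lemma symmetric_operatorD:
  "symmetric_operator T \<Longrightarrow> cinner (blinfun_apply T v) w = cinner v (blinfun_apply T w)"
  by (simp add: symmetric_operator_def)

section \<open>The modulus of a symmetric operator\<close>

text \<open>
  For self-adjoint \<open>T\<close> one has \<open>0 \<le> T\<^sup>2 \<le> \<parallel>T\<parallel>\<^sup>2 \<le> c\<close>, so \<open>c - T\<^sup>2\<close> lies between \<open>0\<close> and \<open>c\<close>.
\<close>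

lemma norm_diff_square_le:
  fixes T :: "'h::chilbert_space operator"
  assumes T: "symmetric_operator T" and c: "(norm T)\<^sup>2 \<le> c"
  shows "norm (c *\<^sub>R id_blinfun - (T o\<^sub>L T)) \<le> c"
proof (rule norm_blinfun_bound)
  show "0 \<le> c" using c by (rule order_trans[rotated]) simp
  fix v
  let ?w = "T (T v)"
  have w: "(norm ?w)\<^sup>2 \<le> c * (norm (T v))\<^sup>2"
  proof -
    have "(norm ?w)\<^sup>2 \<le> (norm T * norm (T v))\<^sup>2"
      by (intro power_mono norm_blinfun) simp
    also have "\<dots> \<le> c * (norm (T v))\<^sup>2"
      unfolding power_mult_distrib using c by (intro mult_right_mono) auto
    finally show ?thesis .
  qed
  have "Re (cinner v ?w) = (norm (T v))\<^sup>2"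
    using symmetric_operatorD[OF T, of v "T v"] Re_cinner_self[of "T v"] by simp
  then have "(norm (c *\<^sub>R v - ?w))\<^sup>2 = c\<^sup>2 * (norm v)\<^sup>2 - 2 * c * (norm (T v))\<^sup>2 + (norm ?w)\<^sup>2"
    by (simp add: power2_norm_diff cinner_scaleR_left power_mult_distrib)
  also have "\<dots> \<le> c\<^sup>2 * (norm v)\<^sup>2"
    using w mult_nonneg_nonneg[OF \<open>0 \<le> c\<close> zero_le_power2[of "norm (T v)"]] by linarith
  finally have "(norm (c *\<^sub>R v - ?w))\<^sup>2 \<le> (c * norm v)\<^sup>2"
    by (simp add: power_mult_distrib)
  then have "norm (c *\<^sub>R v - ?w) \<le> c * norm v"
    by (rule power2_le_imp_le) (simp add: \<open>0 \<le> c\<close>)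
  then show "norm ((c *\<^sub>R id_blinfun - (T o\<^sub>L T)) v) \<le> c * norm v"
    by (simp add: blinfun.diff_left blinfun.scaleR_left)
qed

lemma norm_compose_le:
  "norm S \<le> s \<Longrightarrow> norm T \<le> t \<Longrightarrow> norm (S o\<^sub>L T) \<le> s * t"
  for S T :: "'a::real_normed_vector \<Rightarrow>\<^sub>L 'a"
  by (meson mult_mono norm_blinfun_compose norm_ge_zero order_trans)

text \<open>
  The operator \<open>U\<close> is \<open>\<bar>T\<bar>\<close>, that is, the square root of \<open>1 - X\<close> for \<open>X = 1 - T\<^sup>2\<close>. It is obtained as
  \<open>1 - lim Y\<^sub>n\<close> from \<open>Y\<^sub>0 = 0\<close> and \<open>Y\<^sub>n\<^sub>+\<^sub>1 = (X + Y\<^sub>n\<^sup>2) / 2\<close>. The same recursion started with the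
  number \<open>1\<close> in place of \<open>X\<close> gives an increasing bounded real sequence that dominates the norms
  of the \<open>Y\<^sub>n\<close> and of their increments, so \<open>Y\<close> converges in norm.
\<close>

lemma symmetric_modulus:
  fixes T :: "'h::chilbert_space operator"
  assumes sym: "symmetric_operator T" and T1: "norm T \<le> 1"
  obtains U where "U o\<^sub>L U = T o\<^sub>L T" "\<And>v. 0 \<le> Re (cinner (blinfun_apply U v) v)"
    "\<And>Z. Z o\<^sub>L T = T o\<^sub>L Z \<Longrightarrow> Z o\<^sub>L U = U o\<^sub>L Z"
proof -
  define X where "X = id_blinfun - (T o\<^sub>L T)"
  define Y where "Y = rec_nat 0 (\<lambda>_ Z. (1/2) *\<^sub>R (X + (Z o\<^sub>L Z)))"
  define y where "y = rec_nat 0 (\<lambda>_ z::real. (1 + z * z) / 2)"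
  have Y0: "Y 0 = 0" and YS: "\<And>n. Y (Suc n) = (1/2) *\<^sub>R (X + (Y n o\<^sub>L Y n))"
    by (simp_all add: Y_def)
  have y0: "y 0 = 0" and yS: "\<And>n. y (Suc n) = (1 + y n * y n) / 2"
    by (simp_all add: y_def)
  have X1: "norm X \<le> 1"
    using norm_diff_square_le[OF sym, of 1] T1 by (simp add: X_def power_le_one)
  have y_bounds: "0 \<le> y n \<and> y n \<le> 1" for n
    by (induction n) (auto simp: y0 yS mult_le_one)
  have y_mono: "y n \<le> y (Suc n)" for n
    using zero_le_power2[of "1 - y n"] by (simp add: yS power2_eq_square algebra_simps)
  have Y_le: "norm (Y n) \<le> y n" for n
  proof (induction n)
    case (Suc n)
    have "norm (X + (Y n o\<^sub>L Y n)) \<le> 1 + y n * y n"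
      by (intro norm_triangle_le add_mono X1 norm_compose_le Suc)
    then show ?case by (simp add: YS yS)
  qed (simp add: Y0 y0)
  have commX: "Z o\<^sub>L Y n = Y n o\<^sub>L Z" if "Z o\<^sub>L X = X o\<^sub>L Z" for Z n
  proof (induction n)
    case (Suc n)
    have "Z o\<^sub>L (Y n o\<^sub>L Y n) = (Y n o\<^sub>L Y n) o\<^sub>L Z"
      by (simp add: blinfun_compose_assoc[symmetric] Suc) (simp add: blinfun_compose_assoc Suc)
    then show ?case
      by (simp add: YS that blinfun_compose.scaleR_left blinfun_compose.scaleR_right
          blinfun_compose.add_left blinfun_compose.add_right)
  qed (simp add: Y0 blinfun_compose.zero_left blinfun_compose.zero_right)
  have YY: "Y n o\<^sub>L Y m = Y m o\<^sub>L Y n" for n m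
    by (rule commX) (rule commX[symmetric], simp)
  have step: "norm (Y (Suc n) - Y n) \<le> y (Suc n) - y n" for n
  proof (induction n)
    case 0
    show ?case using Y_le[of 1] by (simp add: Y0 y0)
  next
    case (Suc n)
    have "Y (Suc (Suc n)) - Y (Suc n) = (1/2) *\<^sub>R ((Y (Suc n) - Y n) o\<^sub>L (Y (Suc n) + Y n))"
      unfolding YS[of "Suc n"] using YY[of "Suc n" n]
      by (subst (2) YS) (simp add: blinfun_compose.add_right blinfun_compose.diff_left scaleR_diff_right scaleR_add_right)
    then have "norm (Y (Suc (Suc n)) - Y (Suc n)) = norm ((Y (Suc n) - Y n) o\<^sub>L (Y (Suc n) + Y n)) / 2"
      by simp
    also have "\<dots> \<le> (y (Suc n) - y n) * (y (Suc n) + y n) / 2"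
      by (intro divide_right_mono norm_compose_le Suc norm_triangle_le add_mono Y_le) simp
    also have "\<dots> = y (Suc (Suc n)) - y (Suc n)"
      unfolding yS[of "Suc n"] by (subst (3) yS) (simp add: field_simps)
    finally show ?case .
  qed
  have "convergent y"
    using y_bounds y_mono by (intro Bseq_monoseq_convergent)
      (auto simp: Bseq_def monoseq_Suc intro!: exI[of _ 1])
  then have "summable (\<lambda>n. y (Suc n) - y n)"
    by (auto simp: convergent_def intro: telescope_summable)
  then have "summable (\<lambda>n. Y (Suc n) - Y n)"
    by (rule summable_comparison_test'[where N = 0]) (rule step)
  then have "convergent (\<lambda>n. \<Sum>k<n. Y (Suc k) - Y k)"
    by (simp add: summable_iff_convergent)
  then have "convergent Y" by (simp add: sum_lessThan_telescope Y0)
  then obtain L where L: "Y \<longlonglongrightarrow> L" by (auto simp: convergent_def)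
  have "(\<lambda>n. Y (Suc n)) \<longlonglongrightarrow> (1/2) *\<^sub>R (X + (L o\<^sub>L L))"
    unfolding YS by (intro tendsto_intros L blinfun_compose.tendsto)
  then have L_eq: "L = (1/2) *\<^sub>R (X + (L o\<^sub>L L))"
    using L LIMSEQ_unique LIMSEQ_Suc by blast
  have "2 *\<^sub>R L = X + (L o\<^sub>L L)" by (subst (1) L_eq) simp
  then have LL: "L o\<^sub>L L = 2 *\<^sub>R L - X" by simp
  have "norm (Y n) \<le> 1" for n using Y_le[of n] y_bounds[of n] by simp
  then have L1: "norm L \<le> 1"
    by (intro Lim_bounded[OF tendsto_norm[OF L], of 0]) auto
  define U where "U = id_blinfun - L"
  show ?thesis
  proof
    show "U o\<^sub>L U = T o\<^sub>L T"
      by (simp add: U_def blinfun_compose.diff_left blinfun_compose.diff_right LL X_def scaleR_2)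
    show "0 \<le> Re (cinner (U v) v)" for v
    proof -
      have "Re (cinner (L v) v) \<le> norm (L v) * norm v" by (rule Re_cinner_le)
      also have "\<dots> \<le> 1 * norm v * norm v"
        using norm_blinfun[of L v] mult_right_mono[OF L1, of "norm v"]
        by (intro mult_right_mono) auto
      finally show ?thesis
        by (simp add: U_def blinfun.diff_left cinner.diff_left cinner_self power2_eq_square)
    qed
    fix Z assume Z: "Z o\<^sub>L T = T o\<^sub>L Z"
    have "Z o\<^sub>L (T o\<^sub>L T) = (T o\<^sub>L T) o\<^sub>L Z"
      by (simp add: blinfun_compose_assoc[symmetric] Z) (simp add: blinfun_compose_assoc Z)
    then have ZX: "Z o\<^sub>L X = X o\<^sub>L Z"
      by (simp add: X_def blinfun_compose.diff_left blinfun_compose.diff_right)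
    have "(\<lambda>n. Z o\<^sub>L Y n) \<longlonglongrightarrow> (Z o\<^sub>L L)"
      by (intro tendsto_intros L blinfun_compose.tendsto)
    moreover have "(\<lambda>n. Z o\<^sub>L Y n) \<longlonglongrightarrow> (L o\<^sub>L Z)"
      unfolding commX[OF ZX] by (intro tendsto_intros L blinfun_compose.tendsto)
    ultimately have "Z o\<^sub>L L = L o\<^sub>L Z" by (rule LIMSEQ_unique)
    then show "Z o\<^sub>L U = U o\<^sub>L Z"
      by (simp add: U_def blinfun_compose.diff_left blinfun_compose.diff_right)
  qed
qed

section \<open>Schur's lemma\<close>

lemma symmetric_zero_if_form_zero:
  fixes T :: "'h::chilbert_space operator"
  assumes sym: "symmetric_operator T" and zero: "\<And>v. Re (cinner (T v) v) = 0"
  shows "T v = 0"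
proof -
  have "Re (cinner (T (v + T v)) (v + T v)) = 2 * (norm (T v))\<^sup>2 + Re (cinner (T v) v) + Re (cinner (T (T v)) (T v))"
    using symmetric_operatorD[OF sym, of "T v" v]
    by (simp add: blinfun.add_right cinner_add_left cinner_add_right cinner_self)
  then show ?thesis by (simp add: zero)
qed

text \<open>
  With \<open>U = \<bar>T\<bar>\<close> one has \<open>(U + T) (U - T) = 0\<close>. The kernel of \<open>U + T\<close> is an invariant subspace:
  if it is zero then \<open>T = U\<close>, and if it is everything then \<open>T = - U\<close>.
\<close>

lemma commuting_symmetric_semidefinite:
  fixes T :: "'h::chilbert_space operator"
  assumes irr: "irreducible_operators A" and sym: "symmetric_operator T" and Tbo: "T \<in> bounded_operators"
    and comm: "\<And>a. a \<in> A \<Longrightarrow> a o\<^sub>L T = T o\<^sub>L a"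
  shows "(\<forall>v. 0 \<le> Re (cinner (T v) v)) \<or> (\<forall>v. Re (cinner (T v) v) \<le> 0)"
proof -
  define r where "r = 1 / (norm T + 1)"
  have r: "r > 0" by (simp add: r_def add_nonneg_pos)
  define T' where "T' = r *\<^sub>R T"
  have "norm T' \<le> 1" by (simp add: T'_def r_def add_nonneg_pos)
  moreover have "symmetric_operator T'"
    using sym by (simp add: symmetric_operator_def T'_def blinfun.scaleR_left cinner_scaleR_left cinner_scaleR_right)
  ultimately obtain U where U: "U o\<^sub>L U = T' o\<^sub>L T'" "\<And>v. 0 \<le> Re (cinner (blinfun_apply U v) v)"
    "\<And>Z. Z o\<^sub>L T' = T' o\<^sub>L Z \<Longrightarrow> Z o\<^sub>L U = U o\<^sub>L Z"
    using symmetric_modulus by metis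
  have scale: "scaleC_operator c id_blinfun o\<^sub>L R = R o\<^sub>L scaleC_operator c id_blinfun"
    if "R \<in> bounded_operators" for c and R :: "'h operator"
    using that by (intro blinfun_eqI) (simp add: scaleC_operator.rep_eq bounded_operators_def)
  have T'bo: "T' \<in> bounded_operators"
    using Tbo by (simp add: bounded_operators_def T'_def blinfun.scaleR_left scaleR_scaleC scaleC_scaleC mult.commute)
  have comm_apply: "P (Q v) = Q (P v)" if "P o\<^sub>L Q = Q o\<^sub>L P" for P Q :: "'h operator" and v
    using arg_cong[OF that, of "\<lambda>R. blinfun_apply R v"] by simp
  have UC: "U (c *\<^sub>C v) = c *\<^sub>C U v" for c v
    using comm_apply[OF U(3)[OF scale[OF T'bo], of c], of v] by (simp add: scaleC_operator.rep_eq)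
  have UT: "T' (U v) = U (T' v)" for v
    by (rule comm_apply) (rule U(3), rule refl)
  have aT': "a o\<^sub>L T' = T' o\<^sub>L a" if "a \<in> A" for a
    using comm[OF that] by (simp add: T'_def blinfun_compose.scaleR_left blinfun_compose.scaleR_right)
  have Ua: "a (U v) = U (a v)" if "a \<in> A" for a v
    by (rule comm_apply) (rule U(3), rule aT'[OF that])
  have Ta: "a (T' v) = T' (a v)" if "a \<in> A" for a v
    by (rule comm_apply) (rule aT'[OF that])
  define V where "V = {v. U v + T' v = 0}"
  have "csubspace V"
    unfolding csubspace_def V_def
  proof (safe)
    show "U 0 + T' 0 = 0" by simp
    show "U (v + w) + T' (v + w) = 0" if "U v + T' v = 0" "U w + T' w = 0" for v w
    proof -
      have "U (v + w) + T' (v + w) = (U v + T' v) + (U w + T' w)" by (simp add: blinfun.add_right)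
      then show ?thesis by (simp add: that)
    qed
    show "U (c *\<^sub>C v) + T' (c *\<^sub>C v) = 0" if "U v + T' v = 0" for c v
      by (simp add: UC bounded_operators_scaleC[OF T'bo] scaleC_add_right[symmetric] that scaleC.zero_right)
  qed
  moreover have "closed V"
    unfolding V_def by (intro closed_Collect_eq continuous_intros)
  moreover have "\<forall>a\<in>A. \<forall>v\<in>V. a v \<in> V"
  proof safe
    fix a v assume a: "a \<in> A" and v: "v \<in> V"
    have "U (a v) + T' (a v) = a (U v + T' v)" by (simp add: Ua[OF a] Ta[OF a] blinfun.add_right)
    then show "a v \<in> V" using v by (simp add: V_def)
  qed
  ultimately consider "V = {0}" | "V = UNIV"
    using irr by (auto simp: irreducible_operators_def)
  then show ?thesis
  proof cases
    case 1
    have "U v - T' v \<in> V" for v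
    proof -
      have "U (U v) = T' (T' v)" using arg_cong[OF U(1), of "\<lambda>R. blinfun_apply R v"] by simp
      then show ?thesis by (simp add: V_def blinfun.diff_right UT)
    qed
    then have "T' v = U v" for v using 1 by auto
    then have "0 \<le> Re (cinner (T' v) v)" for v using U(2) by simp
    then show ?thesis using r by (simp add: T'_def blinfun.scaleR_left cinner_scaleR_left zero_le_mult_iff)
  next
    case 2
    then have "T' v = - U v" for v by (auto simp: V_def eq_neg_iff_add_eq_0 add.commute)
    then have "Re (cinner (T' v) v) \<le> 0" for v using U(2) by (simp add: cinner.minus_left)
    then show ?thesis using r by (simp add: T'_def blinfun.scaleR_left cinner_scaleR_left mult_le_0_iff)
  qed
qed

text \<open>
  Schur's lemma for a self-adjoint element \<open>T\<close> of the commutant. Each \<open>T - s\<close> is semidefinite, and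
  the value of the form of \<open>T\<close> at one unit vector determines where its sign changes.
\<close>

lemma commuting_symmetric_scalar:
  fixes T :: "'h::chilbert_space operator"
  assumes irr: "irreducible_operators A" and sym: "symmetric_operator T" and Tbo: "T \<in> bounded_operators"
    and comm: "\<And>a. a \<in> A \<Longrightarrow> a o\<^sub>L T = T o\<^sub>L a"
  obtains r :: real where "\<And>v. T v = r *\<^sub>R v"
proof (cases "\<exists>v::'h. v \<noteq> 0")
  case False
  then have "T v = 0 *\<^sub>R v" for v by metis
  then show ?thesis using that by blast
next
  case True
  then obtain u :: 'h where "u \<noteq> 0" by blast
  define v0 where "v0 = (1 / norm u) *\<^sub>R u"
  have v0: "norm v0 = 1" using \<open>u \<noteq> 0\<close> by (simp add: v0_def)
  define f where "f v = Re (cinner (T v) v)" for v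
  \<comment> \<open>Each \<open>T - s\<close> with \<open>s\<close> real again commutes with \<open>A\<close>.\<close>
  have dich: "(\<forall>v. s * (norm v)\<^sup>2 \<le> f v) \<or> (\<forall>v. f v \<le> s * (norm v)\<^sup>2)" for s
  proof -
    let ?R = "T - s *\<^sub>R id_blinfun"
    have "(\<forall>v. 0 \<le> Re (cinner (?R v) v)) \<or> (\<forall>v. Re (cinner (?R v) v) \<le> 0)"
    proof (rule commuting_symmetric_semidefinite[OF irr])
      show "symmetric_operator ?R"
        using sym by (simp add: symmetric_operator_def blinfun.diff_left blinfun.scaleR_left
            cinner.diff_left cinner.diff_right cinner_scaleR_left cinner_scaleR_right)
      show "?R \<in> bounded_operators"
        using Tbo by (simp add: bounded_operators_def blinfun.diff_left blinfun.scaleR_left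
            scaleR_scaleC scaleC_scaleC mult.commute scaleC.diff_right)
      show "a o\<^sub>L ?R = ?R o\<^sub>L a" if "a \<in> A" for a
        using comm[OF that] by (simp add: blinfun_compose.diff_left blinfun_compose.diff_right
            blinfun_compose.scaleR_left blinfun_compose.scaleR_right)
    qed
    then show ?thesis
      by (simp add: f_def blinfun.diff_left blinfun.scaleR_left cinner.diff_left cinner_scaleR_left cinner_self)
  qed
  let ?r = "f v0"
  have "?r * (norm v)\<^sup>2 \<le> f v" for v
  proof (rule ccontr)
    assume "\<not> ?r * (norm v)\<^sup>2 \<le> f v"
    then have *: "f v < ?r * (norm v)\<^sup>2" by simp
    then have "v \<noteq> 0" by (auto simp: f_def cinner.zero_left cinner.zero_right)
    then have "f v / (norm v)\<^sup>2 < ?r" using * by (simp add: field_simps)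
    then obtain s where s: "f v / (norm v)\<^sup>2 < s" "s < ?r" using dense by blast
    then have "f v < s * (norm v)\<^sup>2" using \<open>v \<noteq> 0\<close> by (simp add: field_simps)
    moreover have "s * (norm v0)\<^sup>2 < f v0" using s v0 by simp
    ultimately show False using dich[of s] by (meson not_le)
  qed
  moreover have "f v \<le> ?r * (norm v)\<^sup>2" for v
  proof (rule ccontr)
    assume "\<not> f v \<le> ?r * (norm v)\<^sup>2"
    then have *: "?r * (norm v)\<^sup>2 < f v" by simp
    then have "v \<noteq> 0" by (auto simp: f_def cinner.zero_left cinner.zero_right)
    then have "?r < f v / (norm v)\<^sup>2" using * by (simp add: field_simps)
    then obtain s where s: "s < f v / (norm v)\<^sup>2" "?r < s" using dense by blast
    then have "s * (norm v)\<^sup>2 < f v" using \<open>v \<noteq> 0\<close> by (simp add: field_simps)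
    moreover have "f v0 < s * (norm v0)\<^sup>2" using s v0 by simp
    ultimately show False using dich[of s] by (meson not_le)
  qed
  ultimately have f_eq: "f v = ?r * (norm v)\<^sup>2" for v using order_antisym by blast
  have "(T - ?r *\<^sub>R id_blinfun) v = 0" for v
  proof (rule symmetric_zero_if_form_zero)
    show "symmetric_operator (T - ?r *\<^sub>R id_blinfun)"
      using sym by (simp add: symmetric_operator_def blinfun.diff_left blinfun.scaleR_left
          cinner.diff_left cinner.diff_right cinner_scaleR_left cinner_scaleR_right)
    show "Re (cinner ((T - ?r *\<^sub>R id_blinfun) v) v) = 0" for v
      using f_eq[of v] by (simp add: f_def blinfun.diff_left blinfun.scaleR_left cinner.diff_left cinner_scaleR_left cinner_self)
  qed
  then have "T v = ?r *\<^sub>R v" for v by (simp add: blinfun.diff_left blinfun.scaleR_left)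
  then show ?thesis using that by blast
qed

text \<open>
  Schur's lemma for an arbitrary element of the commutant, from the self-adjoint case applied to
  \<open>R + R'\<close> and \<open>\<i> (R - R')\<close>, where \<open>R'\<close> is the adjoint of \<open>R\<close>.
\<close>

lemma commuting_adjoint_pair_scalar:
  fixes R R' :: "'h::chilbert_space operator"
  assumes irr: "irreducible_operators A" and Abo: "A \<subseteq> bounded_operators"
    and bo: "R \<in> bounded_operators" "R' \<in> bounded_operators"
    and adjoint: "\<And>v w. cinner (R v) w = cinner v (R' w)"
    and comm: "\<And>a. a \<in> A \<Longrightarrow> a o\<^sub>L R = R o\<^sub>L a" "\<And>a. a \<in> A \<Longrightarrow> a o\<^sub>L R' = R' o\<^sub>L a"
  obtains c where "\<And>v. R v = c *\<^sub>C v"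
proof -
  have adjoint': "cinner (R' v) w = cinner v (R w)" for v w
    by (metis adjoint cinner_commute)
  define T1 where "T1 = R + R'"
  define T2 where "T2 = scaleC_operator \<i> (R - R')"
  have "symmetric_operator T1"
    by (simp add: symmetric_operator_def T1_def blinfun.add_left cinner.add_left cinner.add_right adjoint adjoint')
  moreover have "T1 \<in> bounded_operators"
    using bo by (simp add: T1_def bounded_operators_def blinfun.add_left scaleC_add_right)
  moreover have "a o\<^sub>L T1 = T1 o\<^sub>L a" if "a \<in> A" for a
    using comm[OF that] by (simp add: T1_def blinfun_compose.add_left blinfun_compose.add_right)
  ultimately obtain r1 where r1: "\<And>v. T1 v = r1 *\<^sub>R v"
    using commuting_symmetric_scalar[OF irr] by metis
  have "symmetric_operator T2"
    by (simp add: symmetric_operator_def T2_def scaleC_operator.rep_eq blinfun.diff_left cinner.diff_left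
        cinner.diff_right cinner_scaleC_left cinner_scaleC_right adjoint adjoint' algebra_simps)
  moreover have "T2 \<in> bounded_operators"
    using bo by (simp add: T2_def bounded_operators_def scaleC_operator.rep_eq blinfun.diff_left
        scaleC.diff_right scaleC_scaleC mult.commute)
  moreover have "a o\<^sub>L T2 = T2 o\<^sub>L a" if "a \<in> A" for a
  proof (rule blinfun_eqI)
    fix v
    have "a (R v) = R (a v)" "a (R' v) = R' (a v)"
      using comm[OF that, THEN arg_cong, of "\<lambda>F. blinfun_apply F v"] by simp_all
    then show "(a o\<^sub>L T2) v = (T2 o\<^sub>L a) v"
      using Abo that by (simp add: T2_def scaleC_operator.rep_eq blinfun.diff_left
          bounded_operators_scaleC blinfun.diff_right subset_iff)
  qed
  ultimately obtain r2 where r2: "\<And>v. T2 v = r2 *\<^sub>R v"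
    using commuting_symmetric_scalar[OF irr] by metis
  have "R v = ((complex_of_real r1 - \<i> * complex_of_real r2) / 2) *\<^sub>C v" for v
  proof -
    have 1: "R v + R' v = complex_of_real r1 *\<^sub>C v"
      using r1[of v] by (simp add: T1_def blinfun.add_left scaleR_scaleC)
    have "\<i> *\<^sub>C (R v - R' v) = complex_of_real r2 *\<^sub>C v"
      using r2[of v] by (simp add: T2_def scaleC_operator.rep_eq blinfun.diff_left scaleR_scaleC)
    then have "(- \<i>) *\<^sub>C \<i> *\<^sub>C (R v - R' v) = (- \<i>) *\<^sub>C complex_of_real r2 *\<^sub>C v" by simp
    then have 2: "R v - R' v = (- \<i> * complex_of_real r2) *\<^sub>C v"
      by (simp add: scaleC_scaleC)
    have "R v = complex_of_real (1/2) *\<^sub>C ((R v + R' v) + (R v - R' v))"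
      unfolding scaleR_scaleC[symmetric] by (simp add: scaleR_2[symmetric])
    also have "\<dots> = ((complex_of_real r1 - \<i> * complex_of_real r2) / 2) *\<^sub>C v"
      unfolding 1 2 by (simp add: scaleC_add_left[symmetric] scaleC_scaleC)
    finally show ?thesis .
  qed
  then show ?thesis using that by blast
qed

lemma Re_sum_cinner_power2_le:
  "(Re (\<Sum>i\<in>I. cinner (x i) (u i)))\<^sup>2 \<le> (\<Sum>i\<in>I. (norm (u i))\<^sup>2) * (\<Sum>i\<in>I. (norm (x i))\<^sup>2)"
  for x u :: "'i \<Rightarrow> 'h::complex_inner"
proof -
  have "\<bar>Re (\<Sum>i\<in>I. cinner (x i) (u i))\<bar> \<le> (\<Sum>i\<in>I. norm (x i) * norm (u i))"
    by (rule order_trans[OF abs_Re_le_cmod]) (rule sum_norm_le, rule norm_cinner_le)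
  then have "(Re (\<Sum>i\<in>I. cinner (x i) (u i)))\<^sup>2 \<le> (\<Sum>i\<in>I. norm (x i) * norm (u i))\<^sup>2"
    using abs_le_square_iff[of "Re (\<Sum>i\<in>I. cinner (x i) (u i))" "\<Sum>i\<in>I. norm (x i) * norm (u i)"]
    by (simp add: sum_nonneg)
  also have "\<dots> \<le> (\<Sum>i\<in>I. (norm (x i))\<^sup>2) * (\<Sum>i\<in>I. (norm (u i))\<^sup>2)"
    by (rule Cauchy_Schwarz_ineq_sum)
  finally show ?thesis by (simp add: mult.commute)
qed

section \<open>Strong density of an irreducible algebra\<close>

lemma cstar_subalgebraD:
  assumes "cstar_subalgebra A"
  shows "A \<subseteq> bounded_operators" "0 \<in> A" "\<And>a b. a \<in> A \<Longrightarrow> b \<in> A \<Longrightarrow> a + b \<in> A"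
    "\<And>c a. a \<in> A \<Longrightarrow> scaleC_operator c a \<in> A" "\<And>a b. a \<in> A \<Longrightarrow> b \<in> A \<Longrightarrow> a o\<^sub>L b \<in> A"
    "\<And>a. a \<in> A \<Longrightarrow> adj a \<in> A" "closed A"
  using assms unfolding cstar_subalgebra_def by auto

lemma cstar_subalgebra_scaleR:
  fixes a :: "'h::chilbert_space operator"
  assumes "cstar_subalgebra A" "a \<in> A"
  shows "r *\<^sub>R a \<in> A"
proof -
  have "r *\<^sub>R a = scaleC_operator (complex_of_real r) a"
    by (rule blinfun_eqI) (simp add: blinfun.scaleR_left scaleC_operator.rep_eq scaleR_scaleC)
  then show ?thesis using cstar_subalgebraD(4)[OF assms(1,2)] by simp
qed

lemma cstar_subalgebra_diff:
  "cstar_subalgebra A \<Longrightarrow> a \<in> A \<Longrightarrow> b \<in> A \<Longrightarrow> a - b \<in> A"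
  using cstar_subalgebraD(3)[of A a "(-1) *\<^sub>R b"] cstar_subalgebra_scaleR[of A b "-1"] by simp

text \<open>
  The tuple \<open>p\<close> is the orthogonal projection of the tuple \<open>u\<close> onto the closure of the orbit
  \<open>{(a v\<^sub>i)\<^sub>i | a \<in> A}\<close> in \<open>H\<^sup>I\<close>. Only indices in \<open>I\<close> are constrained, so \<open>p\<close> is unique on \<open>I\<close> only.
\<close>

definition orbit_projection ::
  "'h::chilbert_space operator set \<Rightarrow> 'i set \<Rightarrow> ('i \<Rightarrow> 'h) \<Rightarrow> ('i \<Rightarrow> 'h) \<Rightarrow> ('i \<Rightarrow> 'h) \<Rightarrow> bool" where
  "orbit_projection A I v u p \<longleftrightarrow>
     (\<exists>as. (\<forall>k::nat. as k \<in> A) \<and> (\<forall>i\<in>I. (\<lambda>k. blinfun_apply (as k) (v i)) \<longlonglongrightarrow> p i)) \<and>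
     (\<forall>a\<in>A. (\<Sum>i\<in>I. cinner (blinfun_apply a (v i)) (u i - p i)) = 0)"

lemma orbit_projectionI:
  assumes "\<And>k::nat. as k \<in> A" "\<And>i. i \<in> I \<Longrightarrow> (\<lambda>k. blinfun_apply (as k) (v i)) \<longlonglongrightarrow> p i"
    "\<And>a. a \<in> A \<Longrightarrow> (\<Sum>i\<in>I. cinner (blinfun_apply a (v i)) (u i - p i)) = 0"
  shows "orbit_projection A I v u p"
  using assms unfolding orbit_projection_def by blast

lemma orbit_projectionE:
  assumes "orbit_projection A I v u p"
  obtains as where "\<And>k::nat. as k \<in> A" "\<And>i. i \<in> I \<Longrightarrow> (\<lambda>k. blinfun_apply (as k) (v i)) \<longlonglongrightarrow> p i"
  using assms unfolding orbit_projection_def by blast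

lemma orbit_projection_perp:
  "orbit_projection A I v u p \<Longrightarrow> a \<in> A \<Longrightarrow> (\<Sum>i\<in>I. cinner (blinfun_apply a (v i)) (u i - p i)) = 0"
  unfolding orbit_projection_def by blast

context
  fixes A :: "'h::chilbert_space operator set" and I :: "'i set" and v :: "'i \<Rightarrow> 'h"
  assumes A: "cstar_subalgebra A" and I: "finite I"
begin

lemma orbit_projection_exists: "\<exists>p. orbit_projection A I v u p"
proof -
  define V where "V = (\<lambda>a i. blinfun_apply a (v i)) ` A"
  obtain p vs where p: "\<And>k. vs k \<in> V" "\<And>i. i \<in> I \<Longrightarrow> (\<lambda>k::nat. vs k i) \<longlonglongrightarrow> p i"
    "\<And>x. x \<in> V \<Longrightarrow> Re (\<Sum>i\<in>I. cinner (x i) (p i)) = Re (\<Sum>i\<in>I. cinner (x i) (u i))"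
  proof (rule functional_represented_in_closure[OF I, of V "\<lambda>x. Re (\<Sum>i\<in>I. cinner (x i) (u i))"])
    show "V \<noteq> {}" using cstar_subalgebraD(2)[OF A] by (auto simp: V_def)
    show "(\<lambda>i. x i + y i) \<in> V" if xy: "x \<in> V" "y \<in> V" for x y
    proof -
      obtain a b where "a \<in> A" "b \<in> A" "x = (\<lambda>i. a (v i))" "y = (\<lambda>i. b (v i))"
        using xy by (auto simp: V_def)
      then show ?thesis
        by (auto simp: V_def blinfun.add_left intro!: image_eqI[of _ _ "a + b"] cstar_subalgebraD(3)[OF A])
    qed
    show "(\<lambda>i. r *\<^sub>R x i) \<in> V" if x: "x \<in> V" for x r
    proof -
      obtain a where "a \<in> A" "x = (\<lambda>i. a (v i))" using x by (auto simp: V_def)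
      then show ?thesis
        by (auto simp: V_def blinfun.scaleR_left intro!: image_eqI[of _ _ "r *\<^sub>R a"] cstar_subalgebra_scaleR[OF A])
    qed
    show "(Re (\<Sum>i\<in>I. cinner (x i) (u i)))\<^sup>2 \<le> (\<Sum>i\<in>I. (norm (u i))\<^sup>2) * (\<Sum>i\<in>I. (norm (x i))\<^sup>2)" for x
      by (rule Re_sum_cinner_power2_le)
  qed (auto simp: cinner_add_left cinner_scaleR_left sum.distrib sum_distrib_left)
  have "\<forall>k. \<exists>a\<in>A. vs k = (\<lambda>i. a (v i))" using p(1) by (auto simp: V_def)
  then obtain as where as: "\<And>k. as k \<in> A" "\<And>k. vs k = (\<lambda>i. as k (v i))" by metis
  have "(\<Sum>i\<in>I. cinner (a (v i)) (u i - p i)) = 0" if "a \<in> A" for a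
  proof (rule complex_eq_from_Re)
    fix c
    have "(\<lambda>i. scaleC_operator c a (v i)) \<in> V"
      using cstar_subalgebraD(4)[OF A that] by (auto simp: V_def)
    from p(3)[OF this] show "Re (c * (\<Sum>i\<in>I. cinner (a (v i)) (u i - p i))) = Re (c * 0)"
      by (simp add: scaleC_operator.rep_eq cinner_scaleC_left sum_distrib_left[symmetric] cinner.diff_right
          sum_subtractf right_diff_distrib)
  qed
  moreover have "(\<lambda>k. as k (v i)) \<longlonglongrightarrow> p i" if "i \<in> I" for i
    using p(2)[OF that] by (simp add: as(2))
  ultimately show ?thesis using as(1) orbit_projectionI by blast
qed

lemma orbit_projection_orthogonal:
  assumes "orbit_projection A I v u p" "orbit_projection A I v u' p'"
  shows "(\<Sum>i\<in>I. cinner (p i) (u' i - p' i)) = 0"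
proof -
  obtain as where as: "\<And>k::nat. as k \<in> A" "\<And>i. i \<in> I \<Longrightarrow> (\<lambda>k. blinfun_apply (as k) (v i)) \<longlonglongrightarrow> p i"
    by (rule orbit_projectionE[OF assms(1)]) (rule that)
  have "(\<lambda>k. \<Sum>i\<in>I. cinner (as k (v i)) (u' i - p' i)) \<longlonglongrightarrow> (\<Sum>i\<in>I. cinner (p i) (u' i - p' i))"
    by (intro tendsto_sum cinner.tendsto as tendsto_const)
  moreover have "(\<lambda>k. \<Sum>i\<in>I. cinner (as k (v i)) (u' i - p' i)) = (\<lambda>k. 0)"
    by (intro ext orbit_projection_perp[OF assms(2)] as(1))
  ultimately show ?thesis using LIMSEQ_unique tendsto_const by metis
qed

lemma orbit_projection_selfadjoint:
  assumes "orbit_projection A I v u p" "orbit_projection A I v u' p'"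
  shows "(\<Sum>i\<in>I. cinner (p i) (u' i)) = (\<Sum>i\<in>I. cinner (u i) (p' i))"
proof -
  have "(\<Sum>i\<in>I. cinner (p i) (u' i)) = (\<Sum>i\<in>I. cinner (p i) (p' i))"
    using orbit_projection_orthogonal[OF assms] by (simp add: cinner.diff_right sum_subtractf)
  moreover have "(\<Sum>i\<in>I. cinner (u i) (p' i)) = cnj (\<Sum>i\<in>I. cinner (p' i) (u i))"
    by (simp add: cinner_commute[symmetric])
  moreover have "(\<Sum>i\<in>I. cinner (p' i) (u i)) = (\<Sum>i\<in>I. cinner (p' i) (p i))"
    using orbit_projection_orthogonal[OF assms(2,1)] by (simp add: cinner.diff_right sum_subtractf)
  ultimately show ?thesis by (simp add: cinner_commute[symmetric])
qed

lemma orbit_projection_norm: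
  assumes "orbit_projection A I v u p"
  shows "(\<Sum>i\<in>I. (norm (p i))\<^sup>2) \<le> (\<Sum>i\<in>I. (norm (u i))\<^sup>2)"
proof -
  have "(\<Sum>i\<in>I. Re (cinner (p i) (u i - p i))) = 0"
    using arg_cong[OF orbit_projection_orthogonal[OF assms assms], of Re] by simp
  moreover have "(norm (u i))\<^sup>2 = (norm (p i))\<^sup>2 + 2 * Re (cinner (p i) (u i - p i)) + (norm (u i - p i))\<^sup>2" for i
    using power2_norm_add[of "p i" "u i - p i"] by simp
  ultimately have "(\<Sum>i\<in>I. (norm (u i))\<^sup>2) = (\<Sum>i\<in>I. (norm (p i))\<^sup>2) + (\<Sum>i\<in>I. (norm (u i - p i))\<^sup>2)"
    by (simp add: sum.distrib sum_distrib_left[symmetric])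
  then show ?thesis by (simp add: sum_nonneg)
qed

lemma orbit_projection_add:
  assumes "orbit_projection A I v u p" "orbit_projection A I v u' p'"
  shows "orbit_projection A I v (\<lambda>i. u i + u' i) (\<lambda>i. p i + p' i)"
proof -
  obtain as where as: "\<And>k::nat. as k \<in> A" "\<And>i. i \<in> I \<Longrightarrow> (\<lambda>k. blinfun_apply (as k) (v i)) \<longlonglongrightarrow> p i"
    by (rule orbit_projectionE[OF assms(1)]) (rule that)
  obtain bs where bs: "\<And>k::nat. bs k \<in> A" "\<And>i. i \<in> I \<Longrightarrow> (\<lambda>k. blinfun_apply (bs k) (v i)) \<longlonglongrightarrow> p' i"
    by (rule orbit_projectionE[OF assms(2)]) (rule that)
  show ?thesis
  proof (rule orbit_projectionI)
    show "as k + bs k \<in> A" for k by (intro cstar_subalgebraD(3)[OF A] as bs)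
    show "(\<lambda>k. (as k + bs k) (v i)) \<longlonglongrightarrow> p i + p' i" if "i \<in> I" for i
      unfolding blinfun.add_left by (intro tendsto_add as bs that)
    fix a assume a: "a \<in> A"
    have "(\<Sum>i\<in>I. cinner (a (v i)) (u i + u' i - (p i + p' i))) =
        (\<Sum>i\<in>I. cinner (a (v i)) (u i - p i)) + (\<Sum>i\<in>I. cinner (a (v i)) (u' i - p' i))"
      by (simp add: sum.distrib[symmetric] cinner_add_right[symmetric] algebra_simps)
    then show "(\<Sum>i\<in>I. cinner (a (v i)) (u i + u' i - (p i + p' i))) = 0"
      by (simp add: orbit_projection_perp[OF assms(1) a] orbit_projection_perp[OF assms(2) a])
  qed
qed

lemma orbit_projection_algebra:
  assumes u: "orbit_projection A I v u p" and b: "b \<in> A"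
  shows "orbit_projection A I v (\<lambda>i. b (u i)) (\<lambda>i. b (p i))"
proof -
  obtain as where as: "\<And>k::nat. as k \<in> A" "\<And>i. i \<in> I \<Longrightarrow> (\<lambda>k. blinfun_apply (as k) (v i)) \<longlonglongrightarrow> p i"
    by (rule orbit_projectionE[OF u]) (rule that)
  have bo: "b \<in> bounded_operators" using b cstar_subalgebraD(1)[OF A] by blast
  show ?thesis
  proof (rule orbit_projectionI)
    show "b o\<^sub>L as k \<in> A" for k by (intro cstar_subalgebraD(5)[OF A] as b)
    show "(\<lambda>k. (b o\<^sub>L as k) (v i)) \<longlonglongrightarrow> b (p i)" if "i \<in> I" for i
      unfolding blinfun_apply_blinfun_compose by (intro tendsto_intros as that)
    fix a assume "a \<in> A"
    then have "adj b o\<^sub>L a \<in> A" using b cstar_subalgebraD(5,6)[OF A] by blast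
    from orbit_projection_perp[OF u this]
    show "(\<Sum>i\<in>I. cinner (a (v i)) (b (u i) - b (p i))) = 0"
      by (simp add: cinner_adj[OF bo] blinfun.diff_right)
  qed
qed

lemma orbit_projection_scaleC:
  assumes u: "orbit_projection A I v u p"
  shows "orbit_projection A I v (\<lambda>i. c *\<^sub>C u i) (\<lambda>i. c *\<^sub>C p i)"
proof -
  obtain as where as: "\<And>k::nat. as k \<in> A" "\<And>i. i \<in> I \<Longrightarrow> (\<lambda>k. blinfun_apply (as k) (v i)) \<longlonglongrightarrow> p i"
    by (rule orbit_projectionE[OF u]) (rule that)
  show ?thesis
  proof (rule orbit_projectionI)
    show "scaleC_operator c (as k) \<in> A" for k by (intro cstar_subalgebraD(4)[OF A] as)
    show "(\<lambda>k. scaleC_operator c (as k) (v i)) \<longlonglongrightarrow> c *\<^sub>C p i" if "i \<in> I" for i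
      unfolding scaleC_operator.rep_eq by (intro scaleC.tendsto tendsto_const as that)
    fix a assume a: "a \<in> A"
    have "(\<Sum>i\<in>I. cinner (a (v i)) (c *\<^sub>C u i - c *\<^sub>C p i)) = cnj c * (\<Sum>i\<in>I. cinner (a (v i)) (u i - p i))"
      by (simp add: scaleC.diff_right[symmetric] cinner_scaleC_right sum_distrib_left)
    then show "(\<Sum>i\<in>I. cinner (a (v i)) (c *\<^sub>C u i - c *\<^sub>C p i)) = 0"
      by (simp add: orbit_projection_perp[OF u a])
  qed
qed

lemma orbit_projection_unique:
  assumes "orbit_projection A I v u p" "orbit_projection A I v u q" "i \<in> I"
  shows "p i = q i"
proof -
  have "orbit_projection A I v (\<lambda>i. u i + (-1) *\<^sub>C u i) (\<lambda>i. p i + (-1) *\<^sub>C q i)"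
    by (intro orbit_projection_add orbit_projection_scaleC assms)
  from orbit_projection_norm[OF this]
  have "(\<Sum>i\<in>I. (norm (p i + (-1) *\<^sub>C q i))\<^sup>2) \<le> 0"
    by (simp add: scaleC.minus_left)
  then have "(\<Sum>i\<in>I. (norm (p i - q i))\<^sup>2) = 0"
    by (simp add: scaleC.minus_left order_antisym sum_nonneg)
  then show ?thesis using I \<open>i \<in> I\<close> by (simp add: sum_nonneg_eq_0_iff)
qed

text \<open>
  The orbit closure contains \<open>v\<close> although \<open>A\<close> need not contain the identity: every \<open>b \<in> A\<close>
  annihilates the difference of \<open>v\<close> and its projection.
\<close>

lemma orbit_projection_base:
  assumes nondeg: "\<And>w. (\<And>a. a \<in> A \<Longrightarrow> blinfun_apply a w = 0) \<Longrightarrow> w = 0"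
  shows "orbit_projection A I v v v"
proof -
  obtain p where p: "orbit_projection A I v v p" using orbit_projection_exists by blast
  have "v i - p i = 0" if "i \<in> I" for i
  proof (rule nondeg)
    fix b assume b: "b \<in> A"
    have "orbit_projection A I v (\<lambda>i. b (v i)) (\<lambda>i. b (v i))"
      using b unfolding orbit_projection_def by (auto intro!: exI[of _ "\<lambda>_. b"] simp: cinner.zero_right)
    from orbit_projection_unique[OF this orbit_projection_algebra[OF p b] that]
    show "b (v i - p i) = 0" by (simp add: blinfun.diff_right)
  qed
  then have "p i = v i" if "i \<in> I" for i using that by simp
  with p show ?thesis by (simp add: orbit_projection_def cong: sum.cong)
qed

text \<open>
  The projection onto the orbit closure commutes with the diagonal action of \<open>A\<close> on \<open>H\<^sup>I\<close>, hence so do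
  its matrix entries \<open>H \<rightarrow> H\<close>, and by Schur's lemma they are scalars \<open>c\<^sub>i\<^sub>j\<close>.
\<close>

lemma orbit_projection_scalar_matrix:
  assumes irr: "irreducible_operators A"
  obtains c where "\<And>u. orbit_projection A I v u (\<lambda>i. \<Sum>j\<in>I. c i j *\<^sub>C u j)"
proof -
  \<comment> \<open>\<open>e j w\<close> is the tuple with \<open>w\<close> in place \<open>j\<close> and zeros elsewhere; \<open>R i j\<close> is the matrix entry.\<close>
  define e :: "'i \<Rightarrow> 'h \<Rightarrow> 'i \<Rightarrow> 'h" where "e j w = (\<lambda>k. if k = j then w else 0)" for j w
  have "\<forall>j w. \<exists>p. orbit_projection A I v (e j w) p"
    using orbit_projection_exists by blast
  then obtain P where P: "\<And>j w. orbit_projection A I v (e j w) (P j w)" by metis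
  have e_add: "e j (w + z) = (\<lambda>i. e j w i + e j z i)" for j w z by (auto simp: e_def)
  have e_scale: "e j (c *\<^sub>C w) = (\<lambda>i. c *\<^sub>C e j w i)" for j c w
    by (auto simp: e_def scaleC.zero_right)
  have e_op: "e j (blinfun_apply b w) = (\<lambda>i. b (e j w i))" for j w and b :: "'h operator"
    by (auto simp: e_def)
  have P_add: "P j (w + z) i = P j w i + P j z i" if "i \<in> I" for i j w z
    using orbit_projection_unique[OF P[of j "w + z", unfolded e_add] orbit_projection_add[OF P P] that] .
  have P_scale: "P j (c *\<^sub>C w) i = c *\<^sub>C P j w i" if "i \<in> I" for i j c w
    using orbit_projection_unique[OF P[of j "c *\<^sub>C w", unfolded e_scale] orbit_projection_scaleC[OF P] that] .
  have P_op: "P j (blinfun_apply b w) i = b (P j w i)" if "i \<in> I" "b \<in> A" for i j w and b :: "'h operator"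
    using orbit_projection_unique[OF P[of j "b w", unfolded e_op] orbit_projection_algebra[OF P that(2)] that(1)] .
  have e_inner: "(\<Sum>i\<in>I. cinner (x i) (e j w i)) = cinner (x j) w" if "j \<in> I" for x j w
    using I that by (simp add: e_def if_distrib[of "cinner _"] cinner.zero_right cong: if_cong)
  have e_inner': "(\<Sum>i\<in>I. cinner (e j w i) (x i)) = cinner w (x j)" if "j \<in> I" for x j w
    using I that by (simp add: e_def if_distrib[of "\<lambda>y. cinner y _"] cinner.zero_left cong: if_cong)
  have P_adj: "cinner (P j w i) z = cinner w (P i z j)" if "i \<in> I" "j \<in> I" for i j w z
    using orbit_projection_selfadjoint[OF P[of j w] P[of i z]] that by (simp add: e_inner e_inner')
  have P_norm: "norm (P j w i) \<le> norm w" if "i \<in> I" "j \<in> I" for i j w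
  proof -
    have "(norm (P j w i))\<^sup>2 \<le> (\<Sum>i\<in>I. (norm (P j w i))\<^sup>2)"
      using I that by (intro member_le_sum) auto
    also have "\<dots> \<le> (\<Sum>i\<in>I. (norm (e j w i))\<^sup>2)" by (rule orbit_projection_norm[OF P])
    also have "\<dots> = (norm w)\<^sup>2" using I that by (simp add: e_def if_distrib[of norm] if_distrib[of "\<lambda>x. x\<^sup>2"] cong: if_cong)
    finally show ?thesis by (rule power2_le_imp_le) simp
  qed
  define R where "R i j = Blinfun (\<lambda>w. P j w i)" for i j
  have R: "R i j w = P j w i" if "i \<in> I" "j \<in> I" for i j w
  proof -
    have "bounded_linear (\<lambda>w. P j w i)"
      using that P_norm by (intro bounded_linear_intro[where K = 1])
        (auto simp: P_add scaleR_scaleC P_scale)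
    then show ?thesis by (simp add: R_def bounded_linear_Blinfun_apply)
  qed
  have "\<exists>c. \<forall>w. P j w i = c *\<^sub>C w" if ij: "i \<in> I" "j \<in> I" for i j
  proof -
    have "R i j \<in> bounded_operators" "R j i \<in> bounded_operators"
      using ij by (auto simp: bounded_operators_def R P_scale)
    moreover have "cinner (R i j w) z = cinner w (R j i z)" for w z
      using ij by (simp add: R P_adj)
    moreover have "a o\<^sub>L R i j = R i j o\<^sub>L a" "a o\<^sub>L R j i = R j i o\<^sub>L a" if "a \<in> A" for a
      using ij that by (auto intro!: blinfun_eqI simp: R P_op)
    ultimately obtain c where "\<And>w. R i j w = c *\<^sub>C w"
      using commuting_adjoint_pair_scalar[OF irr cstar_subalgebraD(1)[OF A]] by metis
    then show ?thesis using ij by (auto simp: R)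
  qed
  then obtain c where c: "\<And>i j w. i \<in> I \<Longrightarrow> j \<in> I \<Longrightarrow> P j w i = c i j *\<^sub>C w" by metis
  have sums: "orbit_projection A I v (\<lambda>i. \<Sum>j\<in>J. e j (u j) i) (\<lambda>i. \<Sum>j\<in>J. P j (u j) i)"
    if "finite J" for J and u :: "'i \<Rightarrow> 'h"
    using that
  proof (induction J)
    case empty
    show ?case using orbit_projection_scaleC[OF P, of 0] by (simp add: scaleC.zero_left)
  next
    case (insert j J)
    show ?case using orbit_projection_add[OF P insert.IH, of j "u j"] insert.hyps by simp
  qed
  have "orbit_projection A I v u (\<lambda>i. \<Sum>j\<in>I. c i j *\<^sub>C u j)" for u
  proof -
    have 1: "(\<Sum>j\<in>I. e j (u j) i) = u i" if "i \<in> I" for i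
      using I that by (simp add: e_def)
    have 2: "(\<Sum>j\<in>I. P j (u j) i) = (\<Sum>j\<in>I. c i j *\<^sub>C u j)" if "i \<in> I" for i
      using that by (simp add: c)
    show ?thesis using sums[OF I, of u] 1 2 by (simp add: orbit_projection_def cong: sum.cong)
  qed
  then show ?thesis using that by blast
qed

text \<open>
  The density theorem: a scalar matrix commutes with the diagonal action of any complex-linear
  \<open>T\<close>, so the orbit closure, which contains \<open>v\<close>, also contains \<open>(T v\<^sub>i)\<^sub>i\<close>. No boundedness of \<open>T\<close> is
  needed, nor any independence of the \<open>v\<^sub>i\<close>.
\<close>

theorem irreducible_strongly_dense:
  assumes irr: "irreducible_operators A"
    and nondeg: "\<And>w. (\<And>a. a \<in> A \<Longrightarrow> blinfun_apply a w = 0) \<Longrightarrow> w = 0"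
    and T: "\<And>x y. T (x + y) = T x + T y" "\<And>c x. T (c *\<^sub>C x) = c *\<^sub>C T x"
  obtains as where "\<And>k::nat. as k \<in> A" "\<And>i. i \<in> I \<Longrightarrow> (\<lambda>k. blinfun_apply (as k) (v i)) \<longlonglongrightarrow> T (v i)"
proof -
  obtain c where c: "\<And>u. orbit_projection A I v u (\<lambda>i. \<Sum>j\<in>I. c i j *\<^sub>C u j)"
    using orbit_projection_scalar_matrix[OF irr] by blast
  have v: "(\<Sum>j\<in>I. c i j *\<^sub>C v j) = v i" if "i \<in> I" for i
    using orbit_projection_unique[OF c orbit_projection_base[OF nondeg] that] .
  have T0: "T 0 = 0" using T(2)[of 0 0] by (simp add: scaleC.zero_left)
  have T_sum: "T (\<Sum>j\<in>J. g j) = (\<Sum>j\<in>J. T (g j))" if "finite J" for J and g :: "'i \<Rightarrow> 'h"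
    using that by (induction J) (simp_all add: T T0)
  have "(\<Sum>j\<in>I. c i j *\<^sub>C T (v j)) = T (v i)" if "i \<in> I" for i
    using arg_cong[OF v[OF that], of T] I by (simp add: T_sum T)
  note T_lim = this
  show ?thesis
    by (rule orbit_projectionE[OF c[of "\<lambda>i. T (v i)"]]) (rule that, simp_all add: T_lim)
qed

end

lemma symmetric_adj_compose:
  "c \<in> bounded_operators \<Longrightarrow> symmetric_operator (adj c o\<^sub>L c)"
  by (simp add: symmetric_operator_def cinner_adj cinner_adj_right)

text \<open>
  The adjoint is not strongly continuous, so the density theorem does not provide self-adjoint
  approximants at once. Instead, let \<open>w\<close> be the component of \<open>u = (\<mu>\<^sub>i f\<^sub>i)\<^sub>i\<close> orthogonal, in the real
  sense, to all \<open>(a f\<^sub>i)\<^sub>i\<close> with \<open>a \<in> A\<close> self-adjoint. Testing with \<open>a = c\<^sup>* c\<close> gives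
  \<open>Re \<Sum>\<langle>c f\<^sub>i, c w\<^sub>i\<rangle> = 0\<close> for all \<open>c \<in> A\<close>, hence by density also for \<open>c\<close> replaced by the operator
  \<open>T = \<Sum>\<surd>\<mu>\<^sub>j f\<^sub>j f\<^sub>j\<^sup>*\<close>. This says \<open>Re \<langle>u, w\<rangle> = 0\<close>, so \<open>w = 0\<close>.
\<close>

theorem symmetric_elements_dense_diagonal:
  fixes A :: "'h::chilbert_space operator set" and f :: "'i \<Rightarrow> 'h" and \<mu> :: "'i \<Rightarrow> real"
  assumes A: "cstar_subalgebra A" and irr: "irreducible_operators A"
    and nondeg: "\<And>w. (\<And>a. a \<in> A \<Longrightarrow> blinfun_apply a w = 0) \<Longrightarrow> w = 0"
    and I: "finite I" and \<mu>: "\<And>i. i \<in> I \<Longrightarrow> 0 \<le> \<mu> i"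
    and on: "\<And>i j. i \<in> I \<Longrightarrow> j \<in> I \<Longrightarrow> cinner (f i) (f j) = (if i = j then 1 else 0)"
  obtains ds where "\<And>k::nat. ds k \<in> A" "\<And>k. symmetric_operator (ds k)"
    "\<And>i. i \<in> I \<Longrightarrow> (\<lambda>k. blinfun_apply (ds k) (f i)) \<longlonglongrightarrow> \<mu> i *\<^sub>R f i"
proof -
  define V where "V = (\<lambda>a i. blinfun_apply a (f i)) ` {a \<in> A. symmetric_operator a}"
  define u where "u i = \<mu> i *\<^sub>R f i" for i
  obtain p vs where p: "\<And>k. vs k \<in> V" "\<And>i. i \<in> I \<Longrightarrow> (\<lambda>k::nat. vs k i) \<longlonglongrightarrow> p i"
    "\<And>x. x \<in> V \<Longrightarrow> Re (\<Sum>i\<in>I. cinner (x i) (p i)) = Re (\<Sum>i\<in>I. cinner (x i) (u i))"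
  proof (rule functional_represented_in_closure[OF I, of V "\<lambda>x. Re (\<Sum>i\<in>I. cinner (x i) (u i))"])
    show "V \<noteq> {}" using cstar_subalgebraD(2)[OF A]
      by (auto simp: V_def symmetric_operator_def cinner.zero_left cinner.zero_right)
    show "(\<lambda>i. x i + y i) \<in> V" if xy: "x \<in> V" "y \<in> V" for x y
    proof -
      obtain a b where ab: "a \<in> A" "b \<in> A" "symmetric_operator a" "symmetric_operator b"
        "x = (\<lambda>i. a (f i))" "y = (\<lambda>i. b (f i))"
        using xy by (auto simp: V_def)
      then have "symmetric_operator (a + b)"
        by (simp add: symmetric_operator_def blinfun.add_left cinner_add_left cinner_add_right)
      then show ?thesis using ab
        by (auto simp: V_def blinfun.add_left intro!: image_eqI[of _ _ "a + b"] cstar_subalgebraD(3)[OF A])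
    qed
    show "(\<lambda>i. r *\<^sub>R x i) \<in> V" if x: "x \<in> V" for x r
    proof -
      obtain a where a: "a \<in> A" "symmetric_operator a" "x = (\<lambda>i. a (f i))" using x by (auto simp: V_def)
      then have "symmetric_operator (r *\<^sub>R a)"
        by (simp add: symmetric_operator_def blinfun.scaleR_left cinner_scaleR_left cinner_scaleR_right)
      then show ?thesis using a
        by (auto simp: V_def blinfun.scaleR_left intro!: image_eqI[of _ _ "r *\<^sub>R a"] cstar_subalgebra_scaleR[OF A])
    qed
    show "(Re (\<Sum>i\<in>I. cinner (x i) (u i)))\<^sup>2 \<le> (\<Sum>i\<in>I. (norm (u i))\<^sup>2) * (\<Sum>i\<in>I. (norm (x i))\<^sup>2)" for x
      by (rule Re_sum_cinner_power2_le)
  qed (auto simp: cinner_add_left cinner_scaleR_left sum.distrib sum_distrib_left)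
  have "\<forall>k. \<exists>a. a \<in> A \<and> symmetric_operator a \<and> vs k = (\<lambda>i. a (f i))" using p(1) by (auto simp: V_def)
  then obtain as where as: "\<And>k. as k \<in> A" "\<And>k. symmetric_operator (as k)" "\<And>k. vs k = (\<lambda>i. as k (f i))"
    by metis
  define w where "w i = u i - p i" for i
  have perp: "Re (\<Sum>i\<in>I. cinner (x i) (w i)) = 0" if "x \<in> V" for x
    using p(3)[OF that] by (simp add: w_def cinner.diff_right sum_subtractf)
  have "(\<lambda>k. Re (\<Sum>i\<in>I. cinner (vs k i) (w i))) \<longlonglongrightarrow> Re (\<Sum>i\<in>I. cinner (p i) (w i))"
    by (intro tendsto_Re tendsto_sum cinner.tendsto p(2) tendsto_const)
  then have pw: "0 = Re (\<Sum>i\<in>I. cinner (p i) (w i))"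
    by (simp only: perp[OF p(1)] LIMSEQ_const_iff)
  define T where "T x = (\<Sum>j\<in>I. (complex_of_real (sqrt (\<mu> j)) * cinner x (f j)) *\<^sub>C f j)" for x
  have T_add: "T (x + y) = T x + T y" for x y
    by (simp add: T_def cinner_add_left distrib_left scaleC_add_left sum.distrib)
  have T_scale: "T (c *\<^sub>C x) = c *\<^sub>C T x" for c x
    by (simp add: T_def cinner_scaleC_left scaleC.sum_right scaleC_scaleC mult_ac)
  have Tf: "T (f i) = sqrt (\<mu> i) *\<^sub>R f i" if "i \<in> I" for i
  proof -
    have "T (f i) = (\<Sum>j\<in>I. if j = i then sqrt (\<mu> i) *\<^sub>R f i else 0)"
      unfolding T_def using that by (intro sum.cong) (auto simp: on scaleC.zero_left scaleR_scaleC)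
    then show ?thesis using I that by simp
  qed
  have fT: "cinner (f i) (T x) = sqrt (\<mu> i) * cinner (f i) x" if "i \<in> I" for i x
  proof -
    have "cinner (f i) (T x) = (\<Sum>j\<in>I. if j = i then sqrt (\<mu> i) * cinner (f i) x else 0)"
      unfolding T_def cinner.sum_right using that
      by (intro sum.cong) (auto simp: on cinner_scaleC_right cinner_commute[symmetric])
    then show ?thesis using I that by simp
  qed
  obtain cs where cs: "\<And>k::nat. cs k \<in> A"
    "\<And>i. i \<in> I <+> I \<Longrightarrow> (\<lambda>k. blinfun_apply (cs k) (case_sum f w i)) \<longlonglongrightarrow> T (case_sum f w i)"
    using irreducible_strongly_dense[OF A finite_Plus[OF I I] irr nondeg T_add T_scale, of "case_sum f w"] by metis
  have c_lim: "(\<lambda>k. cs k (f i)) \<longlonglongrightarrow> T (f i)" "(\<lambda>k. cs k (w i)) \<longlonglongrightarrow> T (w i)" if "i \<in> I" for i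
    using cs(2)[of "Inl i"] cs(2)[of "Inr i"] that by auto
  have "Re (\<Sum>i\<in>I. cinner (cs k (f i)) (cs k (w i))) = 0" for k
  proof -
    have bo: "cs k \<in> bounded_operators" using cs(1) cstar_subalgebraD(1)[OF A] by blast
    have "adj (cs k) o\<^sub>L cs k \<in> {a \<in> A. symmetric_operator a}"
      using cs(1) cstar_subalgebraD(5,6)[OF A] symmetric_adj_compose[OF bo] by blast
    then have "(\<lambda>i. (adj (cs k) o\<^sub>L cs k) (f i)) \<in> V"
      unfolding V_def by (rule image_eqI[rotated]) (rule refl)
    from perp[OF this] show ?thesis by (simp add: cinner_adj[OF bo])
  qed
  moreover have "(\<lambda>k. Re (\<Sum>i\<in>I. cinner (cs k (f i)) (cs k (w i)))) \<longlonglongrightarrow> Re (\<Sum>i\<in>I. cinner (T (f i)) (T (w i)))"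
    by (intro tendsto_Re tendsto_sum cinner.tendsto c_lim)
  ultimately have "Re (\<Sum>i\<in>I. cinner (T (f i)) (T (w i))) = 0"
    by (simp add: LIMSEQ_const_iff)
  moreover have "cinner (T (f i)) (T (w i)) = cinner (u i) (w i)" if "i \<in> I" for i
    using that \<mu>[OF that]
    by (simp add: Tf fT u_def cinner_scaleR_left scaleR_conv_of_real mult.assoc[symmetric] of_real_mult[symmetric] del: of_real_mult)
  ultimately have uw: "Re (\<Sum>i\<in>I. cinner (u i) (w i)) = 0" by (simp cong: sum.cong)
  have "(norm (w i))\<^sup>2 = Re (cinner (u i) (w i)) - Re (cinner (p i) (w i))" for i
    using Re_cinner_self[of "w i"] by (simp add: w_def cinner.diff_left)
  then have "(\<Sum>i\<in>I. (norm (w i))\<^sup>2) = Re (\<Sum>i\<in>I. cinner (u i) (w i)) - Re (\<Sum>i\<in>I. cinner (p i) (w i))"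
    by (simp add: sum_subtractf)
  then have "w i = 0" if "i \<in> I" for i
    using uw pw I that by (simp add: sum_nonneg_eq_0_iff)
  then have "p i = u i" if "i \<in> I" for i using that by (simp add: w_def)
  then show ?thesis using that[of as] as p(2) by (simp add: u_def)
qed

section \<open>Positive elements separating orthonormal vectors\<close>

text \<open>
  For self-adjoint \<open>d\<close> and \<open>t > 0\<close> this says that \<open>d\<^sup>2 + t\<close> is onto and \<open>h = d\<^sup>2 (d\<^sup>2 + t)\<^sup>-\<^sup>1\<close>, without
  mentioning the inverse. As \<open>A\<close> may lack an identity, \<open>h\<close> rather than the resolvent is the
  useful element.
\<close>

definition is_cutoff :: "'h::chilbert_space operator \<Rightarrow> real \<Rightarrow> 'h operator \<Rightarrow> bool" where
  "is_cutoff d t h \<longleftrightarrow>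
     (\<forall>z. blinfun_apply h (d (d z) + t *\<^sub>R z) = d (d z)) \<and>
     (\<forall>v. \<exists>z. v = d (d z) + t *\<^sub>R z)"

text \<open>
  The defining equation \<open>h (d\<^sup>2 + t) = d\<^sup>2\<close> is a fixed point equation
  \<open>h = (h (\<parallel>d\<parallel>\<^sup>2 - d\<^sup>2) + d\<^sup>2) / (\<parallel>d\<parallel>\<^sup>2 + t)\<close> for a contraction that preserves the closed set of those
  elements of \<open>A\<close> that commute with \<open>d\<close>.
\<close>

lemma cutoff_exists:
  fixes d :: "'h::chilbert_space operator"
  assumes A: "cstar_subalgebra A" and d: "d \<in> A" "symmetric_operator d" and t: "0 < t"
  obtains h where "h \<in> A" "is_cutoff d t h"
proof -
  define n where "n = (norm d)\<^sup>2"
  have n: "0 \<le> n" by (simp add: n_def)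
  define dd where "dd = d o\<^sub>L d"
  have dd: "dd \<in> A" unfolding dd_def by (rule cstar_subalgebraD(5)[OF A d(1) d(1)])
  define G where "G = n *\<^sub>R id_blinfun - dd"
  have G: "norm G \<le> n"
    unfolding G_def n_def dd_def by (rule norm_diff_square_le[OF d(2) order_refl])
  define F where "F h = (1 / (n + t)) *\<^sub>R ((h o\<^sub>L G) + dd)" for h
  define S where "S = {h \<in> A. h o\<^sub>L d = d o\<^sub>L h}"
  have "closed S"
  proof -
    have "closed (A \<inter> {h. h o\<^sub>L d = d o\<^sub>L h})"
      by (intro closed_Int cstar_subalgebraD(7)[OF A] closed_Collect_eq continuous_intros blinfun_compose.continuous_on)
    then show ?thesis by (simp add: S_def Int_def)
  qed
  then have "complete S" by (simp add: complete_eq_closed)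
  moreover have "S \<noteq> {}" using cstar_subalgebraD(2)[OF A] by (auto simp: S_def blinfun_compose.zero_left)
  moreover have "0 \<le> n / (n + t)" "n / (n + t) < 1" using n t by (auto simp: field_simps)
  moreover have "F ` S \<subseteq> S"
  proof safe
    fix h assume h: "h \<in> S"
    have hG: "h o\<^sub>L G = n *\<^sub>R h - (h o\<^sub>L dd)"
      by (simp add: G_def blinfun_compose.diff_right blinfun_compose.scaleR_right)
    have "F h \<in> A"
      using h unfolding F_def hG S_def
      by (intro cstar_subalgebra_scaleR[OF A] cstar_subalgebraD(3)[OF A] cstar_subalgebra_diff[OF A]
          cstar_subalgebraD(5)[OF A] dd) auto
    moreover have "F h o\<^sub>L d = d o\<^sub>L F h"
    proof -
      have hd: "h o\<^sub>L d = d o\<^sub>L h" using h by (simp add: S_def)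
      have hd': "h o\<^sub>L (d o\<^sub>L R) = d o\<^sub>L (h o\<^sub>L R)" for R :: "'h operator"
        by (simp only: blinfun_compose_assoc[symmetric] hd)
      have "(h o\<^sub>L dd) o\<^sub>L d = d o\<^sub>L (h o\<^sub>L dd)"
        by (simp add: dd_def blinfun_compose_assoc hd hd')
      moreover have "dd o\<^sub>L d = d o\<^sub>L dd" by (simp add: dd_def blinfun_compose_assoc)
      ultimately show ?thesis
        unfolding F_def hG
        by (simp add: hd blinfun_compose.scaleR_left blinfun_compose.scaleR_right blinfun_compose.add_left
            blinfun_compose.add_right blinfun_compose.diff_left blinfun_compose.diff_right)
    qed
    ultimately show "F h \<in> S" by (simp add: S_def)
  qed
  moreover have "dist (F h) (F h') \<le> n / (n + t) * dist h h'" if "h \<in> S" "h' \<in> S" for h h'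
  proof -
    have "F h - F h' = (1 / (n + t)) *\<^sub>R ((h - h') o\<^sub>L G)"
      by (simp add: F_def blinfun_compose.diff_left scaleR_diff_right[symmetric])
    then have "dist (F h) (F h') = norm ((h - h') o\<^sub>L G) / (n + t)"
      using n t by (simp add: dist_norm)
    also have "\<dots> \<le> (norm (h - h') * n) / (n + t)"
      using n t by (intro divide_right_mono norm_compose_le G) auto
    finally show ?thesis by (simp add: dist_norm mult.commute)
  qed
  ultimately have "\<exists>!h\<in>S. F h = h" by (rule Banach_fix)
  then obtain h where h: "h \<in> S" "F h = h" by blast
  have fixed: "h (d (d z)) + t *\<^sub>R h z = d (d z)" for z
  proof -
    have "(n + t) *\<^sub>R h = (n + t) *\<^sub>R F h" by (simp add: h(2))
    also have "\<dots> = (h o\<^sub>L G) + dd" using n t by (simp add: F_def)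
    finally have "((n + t) *\<^sub>R h) z = ((h o\<^sub>L G) + dd) z" by simp
    then show ?thesis
      by (simp add: G_def dd_def blinfun.scaleR_left blinfun.add_left blinfun.diff_left
          blinfun.diff_right blinfun.scaleR_right scaleR_add_left algebra_simps)
  qed
  have hd: "h (d v) = d (h v)" for v
  proof -
    have "(h o\<^sub>L d) v = (d o\<^sub>L h) v" using h(1) by (simp add: S_def)
    then show ?thesis by simp
  qed
  have "\<exists>z. v = d (d z) + t *\<^sub>R z" for v
  proof
    have "d (d (h v)) = d (d v) - t *\<^sub>R h v" using fixed[of v] by (simp add: hd[symmetric] eq_diff_eq)
    \<comment> \<open>The resolvent is \<open>(1 - h) / t\<close>.\<close>
    then show "v = d (d ((1/t) *\<^sub>R (v - h v))) + t *\<^sub>R ((1/t) *\<^sub>R (v - h v))"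
      using t by (simp add: blinfun.scaleR_right blinfun.diff_right)
  qed
  moreover have "h (d (d z) + t *\<^sub>R z) = d (d z)" for z
    using fixed[of z] by (simp add: blinfun.add_right blinfun.scaleR_right)
  ultimately have "is_cutoff d t h" by (auto simp: is_cutoff_def)
  moreover have "h \<in> A" using h(1) by (simp add: S_def)
  ultimately show ?thesis using that by blast
qed

lemma cutoff_norm_le:
  fixes d :: "'h::chilbert_space operator"
  assumes d: "symmetric_operator d" and t: "0 < t" and h: "is_cutoff d t h"
  shows "norm h \<le> 1"
proof (rule norm_blinfun_bound)
  fix v
  obtain z where v: "v = d (d z) + t *\<^sub>R z" using h by (auto simp: is_cutoff_def)
  have hv: "h v = d (d z)" using h by (simp add: is_cutoff_def v)
  have "Re (cinner (d (d z)) z) = (norm (d z))\<^sup>2"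
    using symmetric_operatorD[OF d, of "d z" z] by (simp add: cinner_self)
  then have "(norm v)\<^sup>2 = (norm (d (d z)))\<^sup>2 + 2 * t * (norm (d z))\<^sup>2 + (t * norm z)\<^sup>2"
    by (simp add: v power2_norm_add cinner_scaleR_right power_mult_distrib)
  then have "(norm (h v))\<^sup>2 \<le> (norm v)\<^sup>2" using t by (simp add: hv)
  then show "norm (h v) \<le> 1 * norm v" using power2_le_imp_le by fastforce
qed simp

text \<open>
  With \<open>v = (d\<^sup>2 + t) (d\<^sup>2 + s) z\<close> the difference of the cutoffs at \<open>s \<le> t\<close> maps \<open>v\<close> to
  \<open>(t - s) d\<^sup>2 z\<close>, and the form becomes an explicit nonnegative number.
\<close>

lemma cutoff_antimono:
  fixes d :: "'h::chilbert_space operator"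
  assumes d: "symmetric_operator d" and s: "0 < s" "s \<le> t"
    and hs: "is_cutoff d s h" and ht: "is_cutoff d t k"
  shows "cinner ((h - k) v) v \<in> \<real>\<^sub>\<ge>\<^sub>0"
proof -
  obtain y where y: "v = d (d y) + t *\<^sub>R y" using ht by (auto simp: is_cutoff_def)
  obtain z where z: "y = d (d z) + s *\<^sub>R z" using hs unfolding is_cutoff_def by blast
  have v: "v = d (d (d (d z) + t *\<^sub>R z)) + s *\<^sub>R (d (d z) + t *\<^sub>R z)"
    by (simp add: y z blinfun.add_right blinfun.scaleR_right scaleR_add_right algebra_simps)
  have hv: "h v = d (d (d (d z) + t *\<^sub>R z))"
    unfolding v using hs by (simp add: is_cutoff_def)
  have kv: "k v = d (d (d (d z) + s *\<^sub>R z))"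
    unfolding y z using ht by (simp add: is_cutoff_def)
  have diff: "(h - k) v = (t - s) *\<^sub>R d (d z)"
    by (simp add: blinfun.diff_left hv kv blinfun.add_right blinfun.scaleR_right scaleR_diff_left)
  have "cinner (d (d z)) (d (d (d (d z)))) = complex_of_real ((norm (d (d (d z))))\<^sup>2)"
    using symmetric_operatorD[OF d, of "d (d z)" "d (d (d z))"] by (simp add: cinner_self)
  moreover have "cinner (d (d z)) z = complex_of_real ((norm (d z))\<^sup>2)"
    using symmetric_operatorD[OF d, of "d z" z] by (simp add: cinner_self)
  ultimately have "cinner (d (d z)) v = complex_of_real
      ((norm (d (d (d z))))\<^sup>2 + (t + s) * (norm (d (d z)))\<^sup>2 + s * t * (norm (d z))\<^sup>2)"
    by (subst v) (simp add: blinfun.add_right blinfun.scaleR_right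
        cinner_add_right cinner_scaleR_right cinner_self scaleR_conv_of_real algebra_simps)
  then have "cinner ((h - k) v) v = complex_of_real ((t - s) *
      ((norm (d (d (d z))))\<^sup>2 + (t + s) * (norm (d (d z)))\<^sup>2 + s * t * (norm (d z))\<^sup>2))"
    by (simp only: diff cinner_scaleR_left scaleR_conv_of_real of_real_mult)
  moreover have "0 \<le> (t - s) *
      ((norm (d (d (d z))))\<^sup>2 + (t + s) * (norm (d (d z)))\<^sup>2 + s * t * (norm (d z))\<^sup>2)"
    using s by (intro mult_nonneg_nonneg add_nonneg_nonneg) auto
  ultimately show ?thesis by (simp only: nonneg_Reals_of_real_iff)
qed

text \<open>
  The estimate does not involve \<open>\<parallel>d\<parallel>\<close>. This is essential, since the approximants from the density
  theorem come without any control of their norms.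
\<close>

lemma cutoff_approximate_eigenvector:
  fixes d :: "'h::chilbert_space operator"
  assumes d: "symmetric_operator d" and t: "1 \<le> t" and h: "is_cutoff d t h" and m: "0 \<le> m"
  shows "norm (h f - (m\<^sup>2 / (m\<^sup>2 + t)) *\<^sub>R f) \<le> norm (d f - m *\<^sub>R f)"
proof -
  define r where "r = d f - m *\<^sub>R f"
  obtain z where z: "f = d (d z) + t *\<^sub>R z" using h by (auto simp: is_cutoff_def)
  have hf: "h f = f - t *\<^sub>R z" using h by (simp add: is_cutoff_def z)
  define y where "y = f - (m\<^sup>2 + t) *\<^sub>R z"
  have mt: "1 \<le> m\<^sup>2 + t" using t by (simp add: add_increasing)
  have "(m\<^sup>2 + t) *\<^sub>R (h f - (m\<^sup>2 / (m\<^sup>2 + t)) *\<^sub>R f) = (m\<^sup>2 + t) *\<^sub>R f - (t * (m\<^sup>2 + t)) *\<^sub>R z - m\<^sup>2 *\<^sub>R f"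
    using mt by (simp add: hf scaleR_diff_right mult.commute)
  also have "\<dots> = t *\<^sub>R f - (t * (m\<^sup>2 + t)) *\<^sub>R z" by (simp add: scaleR_add_left)
  also have "\<dots> = t *\<^sub>R y" by (simp add: y_def scaleR_diff_right)
  finally have err: "(m\<^sup>2 + t) * norm (h f - (m\<^sup>2 / (m\<^sup>2 + t)) *\<^sub>R f) = t * norm y"
    using mt t by (metis abs_of_nonneg norm_scaleR order_trans zero_le_one)
  have dy: "d (d y) + t *\<^sub>R y = d r + m *\<^sub>R r"
  proof -
    have "d (d y) + t *\<^sub>R y = d (d f) + t *\<^sub>R f - (m\<^sup>2 + t) *\<^sub>R (d (d z) + t *\<^sub>R z)"
      by (simp add: y_def blinfun.diff_right blinfun.scaleR_right scaleR_diff_right scaleR_add_right mult.commute)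
    also have "\<dots> = d (d f) - m\<^sup>2 *\<^sub>R f"
      unfolding z[symmetric] by (simp add: scaleR_add_left)
    also have "\<dots> = d r + m *\<^sub>R r"
      by (simp add: r_def blinfun.diff_right blinfun.scaleR_right scaleR_diff_right power2_eq_square)
    finally show ?thesis .
  qed
  let ?R = "norm r" and ?Y = "norm y" and ?D = "norm (d y)"
  have "Re (cinner (d (d y) + t *\<^sub>R y) y) = ?D\<^sup>2 + t * ?Y\<^sup>2"
    using symmetric_operatorD[OF d, of "d y" y] by (simp add: cinner_add_left cinner_scaleR_left cinner_self)
  moreover have "Re (cinner (d r + m *\<^sub>R r) y) = Re (cinner r (d y)) + m * Re (cinner r y)"
    using symmetric_operatorD[OF d, of r y] by (simp add: cinner_add_left cinner_scaleR_left)
  ultimately have "?D\<^sup>2 + t * ?Y\<^sup>2 \<le> ?R * ?D + m * (?R * ?Y)"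
    using Re_cinner_le[of r "d y"] mult_left_mono[OF Re_cinner_le[of r y] m] by (simp add: dy)
  moreover have "?R * ?D \<le> ?D\<^sup>2 + ?R\<^sup>2 / 4"
    using zero_le_power2[of "?D - ?R / 2"] by (simp add: power2_eq_square field_simps)
  ultimately have 1: "t * ?Y\<^sup>2 \<le> ?R\<^sup>2 / 4 + m * (?R * ?Y)" by linarith
  have "t * (t * ?Y\<^sup>2) \<le> t * (?R\<^sup>2 / 4 + m * (?R * ?Y))"
    using 1 t by (intro mult_left_mono) auto
  moreover have "2 * (t * (m * (?R * ?Y))) \<le> (t * ?Y)\<^sup>2 + (m * ?R)\<^sup>2"
    using zero_le_power2[of "t * ?Y - m * ?R"] by (simp add: power2_eq_square algebra_simps)
  ultimately have "(t * ?Y)\<^sup>2 \<le> (t / 2 + m\<^sup>2) * ?R\<^sup>2"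
    by (simp add: power2_eq_square algebra_simps)
  also have "\<dots> \<le> (m\<^sup>2 + t)\<^sup>2 * ?R\<^sup>2"
  proof (rule mult_right_mono)
    have "t / 2 + m\<^sup>2 \<le> m\<^sup>2 + t" using t by simp
    also have "\<dots> \<le> (m\<^sup>2 + t)\<^sup>2" using mt self_le_power[of "m\<^sup>2 + t" 2] by simp
    finally show "t / 2 + m\<^sup>2 \<le> (m\<^sup>2 + t)\<^sup>2" .
  qed simp
  finally have "(t * ?Y)\<^sup>2 \<le> ((m\<^sup>2 + t) * ?R)\<^sup>2" by (simp add: power_mult_distrib)
  then have "t * ?Y \<le> (m\<^sup>2 + t) * ?R" using mt by (elim power2_le_imp_le) simp
  then show ?thesis using mt by (simp add: err[symmetric] r_def)
qed

text \<open>
  Let \<open>d\<close> act on the \<open>f\<^sub>i\<close> almost as multiplication by \<open>m\<^sub>i\<close>, where \<open>m\<^sub>i\<^sup>2 = 2 \<sqdot> 4\<^sup>i\<close>. The cutoff \<open>h\<^sub>i\<close> at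
  \<open>t = 4\<^sup>i\<close> then has value about \<open>2/3\<close> at \<open>f\<^sub>i\<close>, and \<open>h\<^sub>i\<^sub>+\<^sub>1\<close> has value about \<open>1/3\<close>. So
  \<open>a\<^sub>i = h\<^sub>i - h\<^sub>i\<^sub>+\<^sub>1\<close> are positive elements that are large at \<open>f\<^sub>i\<close>, and their sum telescopes. They
  replace the exactly orthogonal positive elements that Kadison's transitivity theorem would
  provide.
\<close>

theorem positive_elements_separating_orthonormal:
  fixes A :: "'h::chilbert_space operator set" and f :: "nat \<Rightarrow> 'h"
  assumes A: "cstar_subalgebra A" and irr: "irreducible_operators A"
    and nondeg: "\<And>w. (\<And>a. a \<in> A \<Longrightarrow> blinfun_apply a w = 0) \<Longrightarrow> w = 0"
    and on: "\<And>i j. i < N \<Longrightarrow> j < N \<Longrightarrow> cinner (f i) (f j) = (if i = j then 1 else 0)"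
  obtains a where "\<And>i. a i \<in> A" "\<And>i. positive_operator (a i)" "\<And>i. norm (a i) \<le> 2"
    "norm (\<Sum>i<N. a i) \<le> 2" "\<And>i. i < N \<Longrightarrow> 1/4 \<le> Re (cinner (blinfun_apply (a i) (f i)) (f i))"
proof -
  define m where "m i = sqrt 2 * 2 ^ i" for i :: nat
  have m0: "0 \<le> m i" for i by (simp add: m_def)
  have m2: "(m i)\<^sup>2 = 2 * 4 ^ i" for i
    by (simp add: m_def power_mult_distrib power_mult[symmetric] mult.commute[of i]) (simp add: power_mult)
  obtain ds where ds: "\<And>k::nat. ds k \<in> A" "\<And>k. symmetric_operator (ds k)"
    "\<And>i. i \<in> {..<N} \<Longrightarrow> (\<lambda>k. blinfun_apply (ds k) (f i)) \<longlonglongrightarrow> m i *\<^sub>R f i"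
    by (rule symmetric_elements_dense_diagonal[where I = "{..<N}" and \<mu> = m and f = f,
          OF A irr nondeg finite_lessThan m0 on]) (auto intro: that)
  \<comment> \<open>The error \<open>1/24\<close> enters twice below, and \<open>2/3 - 1/3 - 2/24 = 1/4\<close>.\<close>
  have "\<forall>\<^sub>F k in sequentially. \<forall>i\<in>{..<N}. dist (ds k (f i)) (m i *\<^sub>R f i) < 1/24"
    by (intro eventually_ball_finite ballI finite_lessThan tendstoD ds(3)) auto
  then obtain k where "\<forall>i\<in>{..<N}. dist (ds k (f i)) (m i *\<^sub>R f i) < 1/24"
    by (auto simp: eventually_sequentially)
  then obtain d where d: "d \<in> A" "symmetric_operator d"
    and df: "\<And>i. i < N \<Longrightarrow> norm (d (f i) - m i *\<^sub>R f i) < 1/24"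
    using ds(1,2) by (auto simp: dist_norm)
  have "\<forall>i. \<exists>h. h \<in> A \<and> is_cutoff d (4 ^ i) h"
    using cutoff_exists[OF A d] by (metis zero_less_numeral zero_less_power)
  then obtain h where h: "\<And>i. h i \<in> A" "\<And>i. is_cutoff d (4 ^ i) (h i)" by metis
  have h1: "norm (h i) \<le> 1" for i by (rule cutoff_norm_le[OF d(2) _ h(2)]) simp
  define a where "a i = h i - h (Suc i)" for i
  have aA: "a i \<in> A" for i unfolding a_def by (intro cstar_subalgebra_diff[OF A] h)
  show ?thesis
  proof
    show "a i \<in> A" for i by (rule aA)
    show "positive_operator (a i)" for i
      unfolding positive_operator_def
    proof (intro conjI allI)
      show "a i \<in> bounded_operators" using aA cstar_subalgebraD(1)[OF A] by blast
      show "cinner (a i v) v \<in> \<real>\<^sub>\<ge>\<^sub>0" for v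
        unfolding a_def by (rule cutoff_antimono[OF d(2) _ _ h(2) h(2)]) auto
    qed
    have diff2: "norm (h i - h j) \<le> 2" for i j
      using norm_triangle_ineq4[of "h i" "h j"] h1[of i] h1[of j] by linarith
    show "norm (a i) \<le> 2" for i unfolding a_def by (rule diff2)
    have "(\<Sum>i<n. a i) = h 0 - h n" for n
      unfolding a_def by (induction n) auto
    then show "norm (\<Sum>i<N. a i) \<le> 2" using diff2 by simp
    fix i assume i: "i < N"
    have f1: "norm (f i) = 1" using on[OF i i] cinner_self[of "f i"]
      by (metis norm_ge_zero of_real_eq_1_iff power2_eq_1_iff abs_of_nonneg abs_1 abs_neg_one)
    have est: "\<bar>Re (cinner (h j (f i)) (f i)) - (m i)\<^sup>2 / ((m i)\<^sup>2 + 4 ^ j)\<bar> \<le> 1/24" for j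
    proof -
      let ?g = "h j (f i) - ((m i)\<^sup>2 / ((m i)\<^sup>2 + 4 ^ j)) *\<^sub>R f i"
      have "norm ?g \<le> norm (d (f i) - m i *\<^sub>R f i)"
        by (rule cutoff_approximate_eigenvector[OF d(2) _ h(2) m0]) simp
      then have "norm ?g \<le> 1/24" using df[OF i] by linarith
      moreover have "\<bar>Re (cinner ?g (f i))\<bar> \<le> norm ?g * norm (f i)"
        using abs_Re_le_cmod norm_cinner_le order_trans by blast
      moreover have "Re (cinner ?g (f i)) = Re (cinner (h j (f i)) (f i)) - (m i)\<^sup>2 / ((m i)\<^sup>2 + 4 ^ j)"
        by (simp add: cinner.diff_left cinner_scaleR_left on[OF i i])
      ultimately show ?thesis by (simp add: f1)
    qed
    have "(m i)\<^sup>2 / ((m i)\<^sup>2 + 4 ^ i) = 2/3" "(m i)\<^sup>2 / ((m i)\<^sup>2 + 4 ^ Suc i) = 1/3"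
      by (simp_all add: m2 field_simps)
    then show "1/4 \<le> Re (cinner (a i (f i)) (f i))"
      using est[of i, THEN abs_le_D2] est[of "Suc i", THEN abs_le_D1]
      unfolding a_def blinfun.diff_left cinner.diff_left minus_complex.simps by linarith
  qed
qed

section \<open>Compactness of conjugation maps\<close>

lemma compact_closure_if_approximable:
  fixes W :: "'a::banach set"
  assumes "\<And>e. 0 < e \<Longrightarrow> \<exists>C. compact C \<and> (\<forall>w\<in>W. \<exists>c\<in>C. dist w c \<le> e)"
  shows "compact (closure W)"
  unfolding compact_eq_totally_bounded
proof (intro conjI allI impI)
  show "complete (closure W)" by (simp add: complete_eq_closed)
  fix e :: real assume e: "0 < e"
  then have e4: "0 < e / 4" by simp
  obtain C where C: "compact C" "\<And>w. w \<in> W \<Longrightarrow> \<exists>c\<in>C. dist w c \<le> e / 4"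
    using assms[OF e4] by blast
  have "\<forall>e>0. \<exists>k. finite k \<and> C \<subseteq> (\<Union>x\<in>k. ball x e)"
    using C(1) unfolding compact_eq_totally_bounded by (rule conjunct2)
  then obtain k where k: "finite k" "C \<subseteq> (\<Union>x\<in>k. ball x (e / 4))" using e4 by blast
  have "closure W \<subseteq> (\<Union>x\<in>k. ball x e)"
  proof
    fix y assume "y \<in> closure W"
    then obtain w where w: "w \<in> W" "dist w y < e / 4"
      using e4 unfolding closure_approachable by blast
    then obtain c where c: "c \<in> C" "dist w c \<le> e / 4" using C(2) by blast
    then have "c \<in> (\<Union>x\<in>k. ball x (e / 4))" using k(2) by blast
    then obtain x where x: "x \<in> k" "dist x c < e / 4" by auto
    have "dist x y \<le> dist x c + dist w c + dist w y"
      using dist_triangle[of x y c] dist_triangle[of c y w] by (simp add: dist_commute)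
    also have "\<dots> < e" using w c x e by linarith
    finally show "y \<in> (\<Union>x\<in>k. ball x e)" using x(1) by auto
  qed
  then show "\<exists>k. finite k \<and> closure W \<subseteq> (\<Union>x\<in>k. ball x e)" using k(1) by blast
qed

lemma compact_bounded_combinations:
  fixes E :: "'p \<Rightarrow> 'h::chilbert_space operator"
  assumes "finite P"
  shows "\<exists>C. compact C \<and>
    (\<forall>c. (\<forall>p\<in>P. cmod (c p) \<le> B) \<longrightarrow> (\<Sum>p\<in>P. scaleC_operator (c p) (E p)) \<in> C)"
  using assms
proof (induction P)
  case empty
  show ?case by (intro exI[of _ "{0}"]) auto
next
  case (insert q P)
  then obtain C where C: "compact C"
    "\<And>c. (\<forall>p\<in>P. cmod (c p) \<le> B) \<Longrightarrow> (\<Sum>p\<in>P. scaleC_operator (c p) (E p)) \<in> C" by blast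
  have split: "scaleC_operator z (E q) = Re z *\<^sub>R E q + Im z *\<^sub>R scaleC_operator \<i> (E q)" for z
  proof (rule blinfun_eqI)
    fix v
    have "scaleC_operator z (E q) v = (complex_of_real (Re z) + complex_of_real (Im z) * \<i>) *\<^sub>C E q v"
      by (simp add: scaleC_operator.rep_eq complex_eq[of z, symmetric] mult.commute)
    then show "scaleC_operator z (E q) v = (Re z *\<^sub>R E q + Im z *\<^sub>R scaleC_operator \<i> (E q)) v"
      by (simp add: scaleC_operator.rep_eq blinfun.add_left blinfun.scaleR_left scaleC_add_left
          scaleR_scaleC scaleC_scaleC)
  qed
  have "compact ((\<lambda>z. Re z *\<^sub>R E q + Im z *\<^sub>R scaleC_operator \<i> (E q)) ` cball 0 B)"
    by (intro compact_continuous_image compact_cball continuous_intros)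
  then have "compact ((\<lambda>z. scaleC_operator z (E q)) ` cball 0 B)"
    by (simp only: split[symmetric])
  then have "compact {x + y |x y. x \<in> (\<lambda>z. scaleC_operator z (E q)) ` cball 0 B \<and> y \<in> C}"
    using C(1) by (rule compact_sums)
  moreover have "(\<Sum>p\<in>insert q P. scaleC_operator (c p) (E p))
      \<in> {x + y |x y. x \<in> (\<lambda>z. scaleC_operator z (E q)) ` cball 0 B \<and> y \<in> C}"
    if "\<forall>p\<in>insert q P. cmod (c p) \<le> B" for c
  proof -
    have "(\<Sum>p\<in>insert q P. scaleC_operator (c p) (E p)) =
        scaleC_operator (c q) (E q) + (\<Sum>p\<in>P. scaleC_operator (c p) (E p))"
      using insert.hyps by simp
    moreover have "scaleC_operator (c q) (E q) \<in> (\<lambda>z. scaleC_operator z (E q)) ` cball 0 B"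
      using that by simp
    ultimately show ?thesis using C(2)[of c] that by blast
  qed
  ultimately show ?case by blast
qed

text \<open>Orthonormality of a set of vectors; the empty set is included.\<close>

definition orthonormal :: "'h::complex_inner set \<Rightarrow> bool" where
  "orthonormal G \<longleftrightarrow> (\<forall>g\<in>G. \<forall>g'\<in>G. cinner g g' = (if g = g' then 1 else 0))"

lemma orthonormalD:
  "orthonormal G \<Longrightarrow> g \<in> G \<Longrightarrow> g' \<in> G \<Longrightarrow> cinner g g' = (if g = g' then 1 else 0)"
  unfolding orthonormal_def by blast

lemma orthonormal_projection:
  fixes v :: "'h::complex_inner"
  assumes G: "finite G" "orthonormal G"
  defines "p \<equiv> (\<Sum>g\<in>G. cinner v g *\<^sub>C g)"
  shows "\<And>g. g \<in> G \<Longrightarrow> cinner (v - p) g = 0" "norm p \<le> norm v" "norm (v - p) \<le> norm v"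
proof -
  show perp: "cinner (v - p) g = 0" if "g \<in> G" for g
  proof -
    have "(\<Sum>g'\<in>G. cinner v g' * cinner g' g) = (\<Sum>g'\<in>G. if g' = g then cinner v g else 0)"
      using that by (intro sum.cong) (auto simp: orthonormalD[OF G(2)])
    then show ?thesis using G(1) that
      by (simp add: p_def cinner.diff_left cinner.sum_left cinner_scaleC_left)
  qed
  have "cinner (v - p) p = (\<Sum>g\<in>G. cnj (cinner v g) * cinner (v - p) g)"
    by (subst (2) p_def) (simp add: cinner.sum_right cinner_scaleC_right)
  then have "cinner (v - p) p = 0" by (simp add: perp)
  then have "(norm v)\<^sup>2 = (norm (v - p))\<^sup>2 + (norm p)\<^sup>2"
    using power2_norm_add[of "v - p" p] by simp
  then have "(norm p)\<^sup>2 \<le> (norm v)\<^sup>2" "(norm (v - p))\<^sup>2 \<le> (norm v)\<^sup>2" by simp_all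
  then show "norm p \<le> norm v" "norm (v - p) \<le> norm v"
    using power2_le_imp_le norm_ge_zero by blast+
qed

lemma orthonormal_insert:
  assumes "orthonormal G" and z: "norm z = 1" and perp: "\<And>g. g \<in> G \<Longrightarrow> cinner z g = 0"
  shows "orthonormal (insert z G)"
proof -
  have zz: "cinner z z = 1" by (simp add: cinner_self z)
  have perp': "cinner g z = 0" if "g \<in> G" for g
    using perp[OF that] cinner_commute[of g z] by simp
  have "z \<notin> G" using perp[of z] zz by auto
  then have neq: "g \<noteq> z" "z \<noteq> g" if "g \<in> G" for g using that by auto
  show ?thesis
    unfolding orthonormal_def
  proof (intro ballI)
    fix g g' assume "g \<in> insert z G" "g' \<in> insert z G"
    then consider "g = z" "g' = z" | "g = z" "g' \<in> G" | "g \<in> G" "g' = z" | "g \<in> G" "g' \<in> G"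
      by blast
    then show "cinner g g' = (if g = g' then 1 else 0)"
      by cases (auto simp: zz perp perp' neq orthonormalD[OF assms(1)])
  qed
qed

text \<open>One step of Gram--Schmidt orthogonalisation for each vector of \<open>F\<close>.\<close>

lemma exists_orthonormal_with_smaller_complement:
  fixes F :: "'h::complex_inner set"
  assumes "finite F"
  shows "\<exists>G. finite G \<and> orthonormal G \<and>
    (\<forall>v. (\<forall>g\<in>G. cinner v g = 0) \<longrightarrow> (\<forall>w\<in>F. cinner v w = 0))"
  using assms
proof (induction F)
  case empty
  show ?case by (intro exI[of _ "{}"]) (simp add: orthonormal_def)
next
  case (insert x F)
  from insert.IH obtain G where G: "finite G" "orthonormal G"
    "\<forall>v. (\<forall>g\<in>G. cinner v g = 0) \<longrightarrow> (\<forall>w\<in>F. cinner v w = 0)"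
    by (elim exE conjE) (rule that)
  define y where "y = x - (\<Sum>g\<in>G. cinner x g *\<^sub>C g)"
  have y_perp: "cinner y g = 0" if "g \<in> G" for g
    unfolding y_def by (rule orthonormal_projection(1)[OF G(1,2) that])
  have x_perp: "cinner v x = cinner v y" if "\<forall>g\<in>G. cinner v g = 0" for v
    using that by (simp add: y_def cinner.diff_right cinner.sum_right cinner_scaleC_right)
  show ?case
  proof (cases "y = 0")
    case True
    have "\<forall>w\<in>insert x F. cinner v w = 0" if v: "\<forall>g\<in>G. cinner v g = 0" for v
      using G(3)[THEN spec, THEN mp, OF v] x_perp[OF v] by (simp add: True cinner.zero_right)
    then show ?thesis using G(1,2) by (intro exI[of _ G] conjI allI impI)
  next
    case False
    define z where "z = (1 / norm y) *\<^sub>R y"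
    have "orthonormal (insert z G)"
      using False y_perp by (intro orthonormal_insert G(2)) (simp_all add: z_def cinner_scaleR_left)
    moreover have "\<forall>w\<in>insert x F. cinner v w = 0" if "\<forall>g\<in>insert z G. cinner v g = 0" for v
    proof -
      have v: "\<forall>g\<in>G. cinner v g = 0" and "cinner v z = 0" using that by simp_all
      then have "cinner v y = 0" using False by (simp add: z_def cinner_scaleR_right)
      then show ?thesis
        using G(3)[THEN spec, THEN mp, OF v] x_perp[OF v] by simp
    qed
    moreover have "finite (insert z G)" using G(1) by simp
    ultimately show ?thesis by (intro exI[of _ "insert z G"] conjI allI impI)
  qed
qed

lemma cinner_conj_map:
  "x \<in> bounded_operators \<Longrightarrow> cinner (conj_map x a v) w = cinner (a (x v)) (x w)"
  by (simp add: conj_map_def cinner_adj)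

lemma bounded_clinear_on_conj_map:
  fixes x :: "'h::chilbert_space operator"
  assumes x: "x \<in> bounded_operators" and A: "A \<subseteq> bounded_operators"
  shows "bounded_clinear_on A (conj_map x)"
  unfolding bounded_clinear_on_def
proof (intro conjI ballI allI)
  note bo = bounded_operators_scaleC[OF x] bounded_operators_scaleC[OF adj_in_bounded_operators[OF x]]
  show "conj_map x ` A \<subseteq> bounded_operators"
  proof safe
    fix a assume "a \<in> A"
    then have "a \<in> bounded_operators" using A by blast
    then show "conj_map x a \<in> bounded_operators"
      by (simp add: bounded_operators_def[where ?'h = 'h] conj_map_def bo)
  qed
  show "conj_map x (a + b) = conj_map x a + conj_map x b" for a b
    by (simp add: conj_map_def blinfun_compose.add_left blinfun_compose.add_right)
  show "conj_map x (scaleC_operator c a) = scaleC_operator c (conj_map x a)" for c a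
    by (rule blinfun_eqI) (simp add: conj_map_def scaleC_operator.rep_eq bo)
  have "norm (conj_map x a) \<le> norm (adj x) * norm x * norm a" for a
  proof -
    have "norm (conj_map x a) \<le> norm (adj x) * norm a * norm x"
      unfolding conj_map_def by (intro norm_compose_le order_refl)
    then show ?thesis by (simp add: mult_ac)
  qed
  then show "\<exists>K. \<forall>a\<in>A. norm (conj_map x a) \<le> K * norm a" by blast
qed

text \<open>
  The second hypothesis on \<open>x\<close>, smallness on the orthogonal complement of a finite set \<open>F\<close>, is a
  form of compactness. If \<open>p\<close> is the orthogonal projection onto a finite-dimensional
  space containing \<open>F\<close>, then \<open>x\<^sup>* a x\<close> is close to \<open>p x\<^sup>* a x p\<close>, which ranges over a bounded subset of a
  finite-dimensional space, uniformly for \<open>\<parallel>a\<parallel> \<le> 1\<close>.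
\<close>

lemma conj_map_compact:
  fixes x :: "'h::chilbert_space operator"
  assumes x: "x \<in> bounded_operators" and A: "A \<subseteq> bounded_operators"
    and approx: "\<And>e. 0 < e \<Longrightarrow> \<exists>F. finite F \<and> (\<forall>v. (\<forall>g\<in>F. cinner v g = 0) \<longrightarrow> norm (x v) \<le> e * norm v)"
  shows "compact (closure (conj_map x ` (A \<inter> cball 0 1)))"
proof (rule compact_closure_if_approximable)
  fix e :: real assume e: "0 < e"
  define e' where "e' = e / (2 * (norm x + 1))"
  have nx: "0 < norm x + 1" by (rule add_nonneg_pos) simp_all
  have e': "0 < e'" using e nx by (simp add: e'_def del: distrib_left_numeral)
  have "2 * e' * norm x = e * (norm x / (norm x + 1))"
    by (simp add: e'_def del: distrib_left_numeral)
  also have "\<dots> \<le> e * 1" using e nx by (intro mult_left_mono) (simp_all add: pos_divide_le_eq)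
  finally have e'_le: "2 * e' * norm x \<le> e" by simp
  obtain F where F: "finite F" "\<And>v. (\<forall>g\<in>F. cinner v g = 0) \<Longrightarrow> norm (x v) \<le> e' * norm v"
    using approx[OF e'] by blast
  obtain G where G: "finite G" "orthonormal G"
    and GF: "\<forall>v. (\<forall>g\<in>G. cinner v g = 0) \<longrightarrow> (\<forall>w\<in>F. cinner v w = 0)"
    using exists_orthonormal_with_smaller_complement[OF F(1)] by blast
  define p where "p v = (\<Sum>g\<in>G. cinner v g *\<^sub>C g)" for v
  have p_norm: "norm (p v) \<le> norm v" for v
    unfolding p_def by (rule orthonormal_projection(2)[OF G(1,2)])
  have xp: "norm (x v - x (p v)) \<le> e' * norm v" for v
  proof -
    have "norm (x (v - p v)) \<le> e' * norm (v - p v)"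
    proof (rule F(2), rule GF[THEN spec, THEN mp], rule ballI)
      show "cinner (v - p v) g = 0" if "g \<in> G" for g
        unfolding p_def by (rule orthonormal_projection(1)[OF G(1,2) that])
    qed
    also have "\<dots> \<le> e' * norm v"
      unfolding p_def using e' orthonormal_projection(3)[OF G(1,2)] by (intro mult_left_mono) auto
    finally show ?thesis by (simp add: blinfun.diff_right)
  qed
  define E where "E q = Blinfun (\<lambda>v. cinner v (fst q) *\<^sub>C snd q)" for q :: "'h \<times> 'h"
  have E: "E q v = cinner v (fst q) *\<^sub>C snd q" for q v
    unfolding E_def by (simp add: bounded_linear_Blinfun_apply
        bounded_linear_compose[OF scaleC.bounded_linear_left cinner.bounded_linear_left])
  obtain C where C: "compact C"
    "\<forall>c. (\<forall>q\<in>G \<times> G. cmod (c q) \<le> (norm x)\<^sup>2) \<longrightarrow> (\<Sum>q\<in>G \<times> G. scaleC_operator (c q) (E q)) \<in> C"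
    using compact_bounded_combinations[OF finite_cartesian_product[OF G(1) G(1)], of "(norm x)\<^sup>2" E]
    by (elim exE conjE) (rule that)
  show "\<exists>C. compact C \<and> (\<forall>w\<in>conj_map x ` (A \<inter> cball 0 1). \<exists>c\<in>C. dist w c \<le> e)"
  proof (intro exI conjI ballI)
    show "compact C" by (rule C)
    fix w assume "w \<in> conj_map x ` (A \<inter> cball 0 1)"
    then obtain a where "a \<in> A" and a: "norm a \<le> 1" and w: "w = conj_map x a" by auto
    then have abo: "a \<in> bounded_operators" using A by blast
    have a_le: "norm (a v) \<le> norm v" for v
      using norm_blinfun[of a v] mult_right_mono[OF a norm_ge_zero[of v]] by simp
    define c where "c = (\<lambda>(g, g'). cinner (a (x g)) (x g'))"
    \<comment> \<open>\<open>R\<close> is \<open>p x\<^sup>* a x p\<close>, written in matrix units.\<close>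
    define R where "R = (\<Sum>q\<in>G \<times> G. scaleC_operator (c q) (E q))"
    have "cmod (c q) \<le> (norm x)\<^sup>2" if q: "q \<in> G \<times> G" for q
    proof -
      obtain g g' where gg: "q = (g, g')" "g \<in> G" "g' \<in> G" using q by auto
      have n1: "norm g = 1" if "g \<in> G" for g
        using orthonormalD[OF G(2) that that] by (simp add: norm_eq_sqrt_cinner)
      have "cmod (c q) \<le> norm (a (x g)) * norm (x g')" by (simp add: c_def gg norm_cinner_le)
      also have "\<dots> \<le> norm (x g) * norm (x g')" by (intro mult_right_mono a_le) simp
      also have "\<dots> \<le> norm x * norm x"
        using norm_blinfun[of x g] norm_blinfun[of x g'] by (intro mult_mono) (auto simp: n1 gg)
      finally show ?thesis by (simp add: power2_eq_square)
    qed
    then have "R \<in> C" unfolding R_def by (intro C(2)[THEN spec, THEN mp] ballI)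
    have R_form: "cinner (R v) u = cinner (a (x (p v))) (x (p u))" for v u
    proof -
      have xp_sum: "x (p v) = (\<Sum>g\<in>G. cinner v g *\<^sub>C x g)" for v
        by (simp add: p_def blinfun.sum_right bounded_operators_scaleC[OF x])
      have "cinner (R v) u = (\<Sum>q\<in>G \<times> G. c q * (cinner v (fst q) * cinner (snd q) u))"
        by (simp add: R_def blinfun.sum_left cinner.sum_left scaleC_operator.rep_eq E cinner_scaleC_left)
      also have "\<dots> = (\<Sum>g\<in>G. \<Sum>g'\<in>G. cinner (a (x g)) (x g') * (cinner v g * cinner g' u))"
        by (simp add: sum.cartesian_product c_def case_prod_beta')
      also have "\<dots> = cinner (a (x (p v))) (x (p u))"
        unfolding xp_sum
        by (subst sum.swap) (simp add: blinfun.sum_right bounded_operators_scaleC[OF abo] cinner.sum_left cinner.sum_right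
            cinner_scaleC_left cinner_scaleC_right cinner_commute[symmetric] sum_distrib_left mult_ac)
      finally show ?thesis .
    qed
    have "norm ((w - R) v) \<le> e * norm v" for v
    proof -
      let ?u = "(w - R) v"
      have "cinner ?u ?u = cinner (a (x v)) (x ?u) - cinner (a (x (p v))) (x (p ?u))"
        by (simp only: w blinfun.diff_left cinner.diff_left cinner_conj_map[OF x] R_form)
      also have "\<dots> = cinner (a (x v - x (p v))) (x ?u) + cinner (a (x (p v))) (x ?u - x (p ?u))"
        by (simp add: blinfun.diff_right cinner.diff_left cinner.diff_right)
      finally have "(norm ?u)\<^sup>2 = Re (cinner (a (x v - x (p v))) (x ?u)) + Re (cinner (a (x (p v))) (x ?u - x (p ?u)))"
        using Re_cinner_self[of ?u] by (simp only: plus_complex.simps)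
      also have "\<dots> \<le> (e' * norm v) * (norm x * norm ?u) + (norm x * norm v) * (e' * norm ?u)"
      proof (rule add_mono)
        have "Re (cinner (a (x v - x (p v))) (x ?u)) \<le> norm (a (x v - x (p v))) * norm (x ?u)"
          by (rule Re_cinner_le)
        also have "\<dots> \<le> (e' * norm v) * (norm x * norm ?u)"
          using e' by (intro mult_mono order_trans[OF a_le xp] norm_blinfun) auto
        finally show "Re (cinner (a (x v - x (p v))) (x ?u)) \<le> (e' * norm v) * (norm x * norm ?u)" .
        have "Re (cinner (a (x (p v))) (x ?u - x (p ?u))) \<le> norm (a (x (p v))) * norm (x ?u - x (p ?u))"
          by (rule Re_cinner_le)
        also have "\<dots> \<le> (norm x * norm v) * (e' * norm ?u)"
        proof (intro mult_mono xp)
          have "norm (a (x (p v))) \<le> norm x * norm (p v)"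
            by (rule order_trans[OF a_le norm_blinfun])
          also have "\<dots> \<le> norm x * norm v" by (intro mult_left_mono p_norm) simp
          finally show "norm (a (x (p v))) \<le> norm x * norm v" .
        qed auto
        finally show "Re (cinner (a (x (p v))) (x ?u - x (p ?u))) \<le> (norm x * norm v) * (e' * norm ?u)" .
      qed
      also have "\<dots> = 2 * e' * norm x * (norm v * norm ?u)" by (simp add: algebra_simps)
      also have "\<dots> \<le> e * (norm v * norm ?u)" using e'_le by (intro mult_right_mono) auto
      finally have "norm ?u * norm ?u \<le> (e * norm v) * norm ?u" by (simp add: power2_eq_square mult_ac)
      then show ?thesis using e by (cases "?u = 0") auto
    qed
    then have "dist w R \<le> e" unfolding dist_norm using e by (intro norm_blinfun_bound) auto
    then show "\<exists>c\<in>C. dist w c \<le> e" using \<open>R \<in> C\<close> by blast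
  qed
qed

section \<open>Domination by a compact map\<close>

text \<open>
  If \<open>x\<close> is not small on the orthogonal complement of any finite set, orthonormal
  vectors \<open>x e\<^sub>i\<close> with \<open>\<parallel>e\<^sub>i\<parallel> \<le> 1/r\<close>
  are chosen one after the other, each new vector orthogonal to all \<open>x\<^sup>* x e\<^sub>j\<close> chosen before.
\<close>

lemma exists_vectors_with_orthonormal_images:
  fixes x :: "'h::chilbert_space operator" and N :: nat
  assumes x: "x \<in> bounded_operators" and r: "0 < r"
    and large: "\<And>F. finite F \<Longrightarrow> \<exists>v. (\<forall>g\<in>F. cinner v g = 0) \<and> r * norm v < norm (x v)"
  shows "\<exists>e. (\<forall>i<N. r * norm (e i) \<le> 1) \<and>
    (\<forall>i<N. \<forall>j<N. cinner (x (e i)) (x (e j)) = (if i = j then 1 else 0))"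
proof (induction N)
  case 0
  show ?case by simp
next
  case (Suc N)
  then obtain e where "\<forall>i<N. r * norm (e i) \<le> 1"
    "\<forall>i<N. \<forall>j<N. cinner (x (e i)) (x (e j)) = (if i = j then 1 else 0)"
    by (elim exE conjE) (rule that)
  note e = this[rule_format]
  have "finite ((\<lambda>j. adj x (x (e j))) ` {..<N})" by simp
  from large[OF this] obtain v where v: "\<And>j. j < N \<Longrightarrow> cinner v (adj x (x (e j))) = 0"
    "r * norm v < norm (x v)" by auto
  have pos: "0 < norm (x v)" using v(2) r by (meson le_less_trans mult_nonneg_nonneg norm_ge_zero less_imp_le)
  define u where "u = (1 / norm (x v)) *\<^sub>R v"
  have u1: "r * norm u \<le> 1" using v(2) pos by (simp add: u_def field_simps)
  have u2: "cinner (x u) (x u) = 1" using pos by (simp add: cinner_self u_def blinfun.scaleR_right)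
  have u3: "cinner (x u) (x (e j)) = 0" if "j < N" for j
    using v(1)[OF that] by (simp add: u_def blinfun.scaleR_right cinner_scaleR_left cinner_adj_right[OF x])
  have u4: "cinner (x (e j)) (x u) = 0" if "j < N" for j
    using u3[OF that] cinner_commute[of "x (e j)" "x u"] by simp
  show ?case
  proof (intro exI[of _ "e(N := u)"] conjI allI impI)
    fix i assume i: "i < Suc N"
    show "r * norm ((e(N := u)) i) \<le> 1" using i e(1)[of i] u1 by (cases "i = N") auto
    fix j assume j: "j < Suc N"
    show "cinner (x ((e(N := u)) i)) (x ((e(N := u)) j)) = (if i = j then 1 else 0)"
    proof (cases "i = N"; cases "j = N")
      show ?thesis if "i \<noteq> N" "j \<noteq> N" using that i j e(2)[of i j] by simp
    qed (use i j in \<open>simp_all add: u2 u3 u4\<close>)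
  qed
qed

lemma pigeonhole_large_fibre:
  fixes \<kappa> :: "nat \<Rightarrow> 'b"
  assumes k: "finite k" and N: "card k * L < N" and \<kappa>: "\<And>i. i < N \<Longrightarrow> \<kappa> i \<in> k"
  shows "\<exists>y\<in>k. L < card {i. i < N \<and> \<kappa> i = y}"
proof (rule ccontr)
  assume "\<not> ?thesis"
  then have le: "card {i. i < N \<and> \<kappa> i = y} \<le> L" if "y \<in> k" for y using that by (meson not_le)
  have "{..<N} \<subseteq> (\<Union>y\<in>k. {i. i < N \<and> \<kappa> i = y})" using \<kappa> by auto
  then have "N \<le> card (\<Union>y\<in>k. {i. i < N \<and> \<kappa> i = y})"
    using card_mono[of "\<Union>y\<in>k. {i. i < N \<and> \<kappa> i = y}" "{..<N}"] k by simp
  also have "\<dots> \<le> (\<Sum>y\<in>k. card {i. i < N \<and> \<kappa> i = y})" by (rule card_UN_le[OF k])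
  also have "\<dots> \<le> (\<Sum>y\<in>k. L)" by (rule sum_mono[OF le])
  finally show False using N by simp
qed

lemma irreducible_nondegenerate:
  fixes A :: "'h::chilbert_space operator set"
  assumes A: "A \<subseteq> bounded_operators" and irr: "irreducible_operators A" and nz: "\<not> A \<subseteq> {0}"
    and w: "\<And>a. a \<in> A \<Longrightarrow> blinfun_apply a w = 0"
  shows "w = 0"
proof -
  define V where "V = (\<Inter>a\<in>A. {v. blinfun_apply a v = 0})"
  have "csubspace V"
    using A by (auto simp: csubspace_def V_def blinfun.add_right bounded_operators_scaleC scaleC.zero_right subset_iff)
  moreover have "closed V"
    unfolding V_def by (intro closed_INT ballI closed_Collect_eq continuous_intros)
  moreover have "\<forall>a\<in>A. \<forall>v\<in>V. blinfun_apply a v \<in> V" by (auto simp: V_def)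
  ultimately have "V = {0} \<or> V = UNIV" using irr by (auto simp: irreducible_operators_def)
  moreover have "V \<noteq> UNIV"
  proof
    assume "V = UNIV"
    then have "blinfun_apply a v = 0" if "a \<in> A" for a v using that by (auto simp: V_def)
    then have "a = 0" if "a \<in> A" for a using that by (intro blinfun_eqI) simp
    then show False using nz by blast
  qed
  moreover have "w \<in> V" using w by (simp add: V_def)
  ultimately show ?thesis by blast
qed

text \<open>
  Otherwise take the separating elements \<open>a\<^sub>i\<close> for arbitrarily many orthonormal vectors \<open>x e\<^sub>i\<close>. As
  \<open>S\<close> is compact, many of the operators \<open>S b\<^sub>i\<close>, with \<open>b\<^sub>i = a\<^sub>i / 2\<close> in the unit ball, are close to
  each other, and since \<open>S b\<^sub>i\<close> dominates \<open>x\<^sup>* b\<^sub>i x\<close>, all of these have a form bounded below by a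
  constant at the vector \<open>e\<^sub>i\<close> belonging to one of them. Their sum is therefore large at \<open>e\<^sub>i\<close>, against
  \<open>\<parallel>S (\<Sum>b\<^sub>j)\<parallel> \<le> K\<close>, where \<open>K\<close> bounds \<open>S\<close>.
\<close>

theorem small_on_finite_codimension_if_dominated:
  fixes A :: "'h::chilbert_space operator set" and x :: "'h operator"
  assumes A: "cstar_subalgebra A" and irr: "irreducible_operators A" and nz: "\<not> A \<subseteq> {0}"
    and S: "compact_operator_on A S" and x: "x \<in> bounded_operators"
    and pos: "positive_map_on A (conj_map x)" and dom: "map_le_on A (conj_map x) S" and r: "0 < r"
  shows "\<exists>F. finite F \<and> (\<forall>v. (\<forall>g\<in>F. cinner v g = 0) \<longrightarrow> norm (x v) \<le> r * norm v)"
proof (rule ccontr)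
  assume "\<not> ?thesis"
  then have large: "\<exists>v. (\<forall>g\<in>F. cinner v g = 0) \<and> r * norm v < norm (x v)" if "finite F" for F
    using that by (meson not_le)
  have Abo: "A \<subseteq> bounded_operators" by (rule cstar_subalgebraD(1)[OF A])
  have nondeg: "w = 0" if "\<And>a. a \<in> A \<Longrightarrow> blinfun_apply a w = 0" for w
    using irreducible_nondegenerate[OF Abo irr nz that] .
  have S_add: "S (a + b) = S a + S b" if "a \<in> A" "b \<in> A" for a b
    using S that by (simp add: compact_operator_on_def bounded_clinear_on_def)
  have "\<exists>K. \<forall>a\<in>A. norm (S a) \<le> K * norm a"
    using S by (simp add: compact_operator_on_def bounded_clinear_on_def)
  then obtain K where "\<forall>a\<in>A. norm (S a) \<le> K * norm a" by blast
  then have K: "norm (S a) \<le> K * norm a" if "a \<in> A" for a using that by blast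
  have dominated: "Re (cinner (a (x v)) (x v)) \<le> Re (cinner (S a v) v)"
    if "a \<in> A" "positive_operator a" for a v
  proof -
    have "positive_operator (S a - conj_map x a)"
      using dom that by (simp add: map_le_on_def positive_map_on_def)
    then have "cinner ((S a - conj_map x a) v) v \<in> \<real>\<^sub>\<ge>\<^sub>0" by (simp add: positive_operator_def)
    then have "0 \<le> Re (cinner ((S a - conj_map x a) v) v)" by (simp add: complex_nonneg_Reals_iff)
    then show ?thesis by (simp add: blinfun.diff_left cinner.diff_left cinner_conj_map[OF x])
  qed
  have S_pos: "0 \<le> Re (cinner (S a v) v)" if "a \<in> A" "positive_operator a" for a v
  proof -
    have "positive_operator (conj_map x a)" using pos that by (simp add: positive_map_on_def)
    then have "cinner (a (x v)) (x v) \<in> \<real>\<^sub>\<ge>\<^sub>0"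
      by (simp add: positive_operator_def cinner_conj_map[OF x])
    then show ?thesis using dominated[OF that, of v] by (simp add: complex_nonneg_Reals_iff)
  qed
  \<comment> \<open>Chosen so that \<open>2 \<delta> / r\<^sup>2 = 1/16\<close>, half of the lower bound \<open>1/8\<close> for the form of \<open>S b\<^sub>i\<close> at \<open>e\<^sub>i\<close>.\<close>
  define \<delta> where "\<delta> = r\<^sup>2 / 32"
  have \<delta>: "0 < \<delta>" using r by (simp add: \<delta>_def)
  have "\<forall>e>0. \<exists>k. finite k \<and> closure (S ` (A \<inter> cball 0 1)) \<subseteq> (\<Union>y\<in>k. ball y e)"
    using S unfolding compact_operator_on_def compact_eq_totally_bounded by blast
  then obtain k where k: "finite k" "closure (S ` (A \<inter> cball 0 1)) \<subseteq> (\<Union>y\<in>k. ball y \<delta>)"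
    using \<delta> by blast
  obtain L :: nat where L: "16 * (\<bar>K\<bar> / r\<^sup>2) < real L" using reals_Archimedean2 by blast
  define N where "N = card k * L + 1"
  have "\<exists>e. (\<forall>i<N. r * norm (e i) \<le> 1) \<and>
      (\<forall>i<N. \<forall>j<N. cinner (x (e i)) (x (e j)) = (if i = j then 1 else 0))"
    by (rule exists_vectors_with_orthonormal_images[OF x r]) (rule large)
  then obtain e where "\<forall>i<N. r * norm (e i) \<le> 1"
    "\<forall>i<N. \<forall>j<N. cinner (x (e i)) (x (e j)) = (if i = j then 1 else 0)"
    by (elim exE conjE) (rule that)
  note e = this[rule_format]
  obtain a where a: "\<And>i. a i \<in> A" "\<And>i. positive_operator (a i)" "\<And>i. norm (a i) \<le> 2"
    "norm (\<Sum>i<N. a i) \<le> 2" "\<And>i. i < N \<Longrightarrow> 1/4 \<le> Re (cinner (blinfun_apply (a i) (x (e i))) (x (e i)))"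
    by (rule positive_elements_separating_orthonormal[where f = "\<lambda>i. x (e i)" and N = N, OF A irr])
      (rule nondeg, blast, rule e(2), assumption+, rule that)
  define b where "b i = (1/2) *\<^sub>R a i" for i
  have bA: "b i \<in> A" for i unfolding b_def by (rule cstar_subalgebra_scaleR[OF A a(1)])
  have b_pos: "positive_operator (b i)" for i
    using a(2)[of i] Abo bA[of i]
    by (auto simp: positive_operator_def b_def blinfun.scaleR_left cinner_scaleR_left complex_nonneg_Reals_iff)
  have e_norm: "(norm (e i))\<^sup>2 \<le> 1 / r\<^sup>2" if "i < N" for i
  proof -
    have "(r * norm (e i))\<^sup>2 \<le> 1" using e(1)[OF that] r by (intro power_le_one) auto
    then show ?thesis using r by (simp add: power_mult_distrib field_simps)
  qed
  have "\<exists>y\<in>k. dist y (S (b i)) < \<delta>" for i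
  proof -
    have "norm (b i) \<le> 1" using a(3)[of i] by (simp add: b_def)
    then have "S (b i) \<in> closure (S ` (A \<inter> cball 0 1))"
      using bA[of i] by (intro subsetD[OF closure_subset]) auto
    then have "S (b i) \<in> (\<Union>y\<in>k. ball y \<delta>)" using k(2) by blast
    then show ?thesis by auto
  qed
  then obtain \<kappa> where \<kappa>: "\<And>i. \<kappa> i \<in> k" "\<And>i. dist (\<kappa> i) (S (b i)) < \<delta>" by metis
  obtain y where y: "y \<in> k" "L < card {i. i < N \<and> \<kappa> i = y}"
    using pigeonhole_large_fibre[OF k(1), of L N \<kappa>] \<kappa>(1) by (auto simp: N_def)
  define J where "J = {i. i < N \<and> \<kappa> i = y}"
  have J: "finite J" "J \<subseteq> {..<N}" "L < card J" using y(2) by (auto simp: J_def)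
  then obtain i where i: "i \<in> J" by (metis card.empty equals0I not_less0)
  then have iN: "i < N" by (simp add: J_def)
  have form_i: "1/16 \<le> Re (cinner (S (b j) (e i)) (e i))" if "j \<in> J" for j
  proof -
    have "1/8 \<le> Re (cinner (S (b i) (e i)) (e i))"
      using dominated[OF bA b_pos, of i "e i"] a(5)[OF iN]
      by (simp add: b_def blinfun.scaleR_left cinner_scaleR_left)
    moreover have "Re (cinner ((S (b i) - S (b j)) (e i)) (e i)) \<le> 1/16"
    proof -
      have "dist (S (b i)) (S (b j)) \<le> dist y (S (b i)) + dist y (S (b j))"
        by (rule dist_triangle3)
      also have "\<dots> \<le> 2 * \<delta>"
        using \<kappa>(2)[of i] \<kappa>(2)[of j] i that by (simp add: J_def)
      finally have nd: "norm (S (b i) - S (b j)) \<le> 2 * \<delta>" by (simp add: dist_norm)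
      have "Re (cinner ((S (b i) - S (b j)) (e i)) (e i)) \<le> norm ((S (b i) - S (b j)) (e i)) * norm (e i)"
        by (rule Re_cinner_le)
      also have "\<dots> \<le> (2 * \<delta> * norm (e i)) * norm (e i)"
        using nd by (intro mult_right_mono order_trans[OF norm_blinfun] mult_right_mono) auto
      also have "\<dots> = 2 * \<delta> * (norm (e i))\<^sup>2" by (simp add: power2_eq_square)
      also have "\<dots> \<le> 2 * \<delta> * (1 / r\<^sup>2)" using \<delta> by (intro mult_left_mono e_norm[OF iN]) auto
      also have "\<dots> = 1/16" using r by (simp add: \<delta>_def)
      finally show ?thesis .
    qed
    ultimately show ?thesis by (simp add: blinfun.diff_left cinner.diff_left)
  qed
  have S0: "S 0 = 0" using S_add[of 0 0] cstar_subalgebraD(2)[OF A] by simp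
  have sums: "(\<Sum>j<n. b j) \<in> A \<and> S (\<Sum>j<n. b j) = (\<Sum>j<n. S (b j))" for n
    by (induction n) (simp_all add: S0 S_add bA cstar_subalgebraD[OF A])
  have "real L / 16 \<le> real (card J) * (1/16)" using J(3) by simp
  also have "\<dots> = (\<Sum>j\<in>J. 1/16)" by simp
  also have "\<dots> \<le> (\<Sum>j\<in>J. Re (cinner (S (b j) (e i)) (e i)))" by (rule sum_mono[OF form_i])
  also have "\<dots> \<le> (\<Sum>j<N. Re (cinner (S (b j) (e i)) (e i)))"
    using J by (intro sum_mono2) (auto intro: S_pos bA b_pos)
  also have "\<dots> = Re (cinner (S (\<Sum>j<N. b j) (e i)) (e i))"
    using sums[of N] by (simp add: blinfun.sum_left cinner.sum_left)
  also have "\<dots> \<le> norm (S (\<Sum>j<N. b j) (e i)) * norm (e i)" by (rule Re_cinner_le)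
  also have "\<dots> \<le> (\<bar>K\<bar> * norm (e i)) * norm (e i)"
  proof (intro mult_right_mono order_trans[OF norm_blinfun])
    have "norm (\<Sum>j<N. b j) \<le> 1" using a(4) by (simp add: b_def scaleR_sum_right[symmetric])
    then have "norm (S (\<Sum>j<N. b j)) \<le> \<bar>K\<bar> * 1"
      using K sums[of N] by (meson abs_ge_self abs_ge_zero mult_mono norm_ge_zero order_trans)
    then show "norm (S (\<Sum>j<N. b j)) \<le> \<bar>K\<bar>" by simp
  qed auto
  also have "\<dots> = \<bar>K\<bar> * (norm (e i))\<^sup>2" by (simp add: power2_eq_square)
  also have "\<dots> \<le> \<bar>K\<bar> * (1 / r\<^sup>2)" by (intro mult_left_mono e_norm[OF iN]) simp
  finally show False using L by (simp add: mult.commute)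
qed

theorem proposition2p3p3:
  fixes A :: "('h::chilbert_space \<Rightarrow>\<^sub>L 'h) set"
    and S :: "('h \<Rightarrow>\<^sub>L 'h) \<Rightarrow> ('h \<Rightarrow>\<^sub>L 'h)"
    and x :: "'h \<Rightarrow>\<^sub>L 'h"
  assumes "cstar_subalgebra A"
    and "irreducible_operators A"
    and "compact_operator_on A S"
    and "x \<in> bounded_operators"
    and "positive_map_on A (conj_map x)"
    and "map_le_on A (conj_map x) S"
  shows "compact_operator_on A (conj_map x)"
  unfolding compact_operator_on_def
proof
  have Abo: "A \<subseteq> bounded_operators" by (rule cstar_subalgebraD(1)[OF assms(1)])
  show "bounded_clinear_on A (conj_map x)"
    by (rule bounded_clinear_on_conj_map[OF assms(4) Abo])
  show "compact (closure (conj_map x ` (A \<inter> cball 0 1)))"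
  \<comment> \<open>The zero algebra is irreducible when \<open>dim H \<le> 1\<close>; every other irreducible algebra acts nondegenerately.\<close>
  proof (cases "A \<subseteq> {0}")
    case True
    then have "conj_map x ` (A \<inter> cball 0 1) \<subseteq> {conj_map x 0}" by blast
    then have "finite (conj_map x ` (A \<inter> cball 0 1))" by (rule finite_subset) simp
    then show ?thesis by (simp add: finite_imp_closed finite_imp_compact closure_closed)
  next
    case False
    show ?thesis
      by (rule conj_map_compact[OF assms(4) Abo])
        (rule small_on_finite_codimension_if_dominated[OF assms(1,2) False assms(3-6)])
  qed
qed

end
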